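(* Let $n\ge 1$ and $p>n$ be integers, let $\mathcal X$ be a measurable set, let $X_1,\dots,X_n\in\mathcal X$ be deterministic points, let $f:\mathcal X\to\mathbb R$ be an (unknown) function, and let $Y_i=f(X_i)+W_i$ for $1\le i\le n$, where $W_1,\dots,W_n$ are i.i.d. Gaussian $N(0,\sigma^2)$ with $\sigma^2>0$. Let $\phi_1,\dots,\phi_p:\mathcal X\to\mathbb R$ be functions with $\frac1n\sum_{i=1}^n\phi_j(X_i)^2=1$ for every $j$. Fix $\alpha\in(0,1)$. Let $\hat f_n=f_{\hat\theta_n}$ be the exponential weights aggregate of the least squares estimators (defined in the context) with temperature parameter $\lambda=\frac{n}{4\sigma^2}$ and with prior $$\pi_J=\frac{\alpha^{|J|}}{\sum_{j=0}^n\alpha^j}\binom{p}{|J|}^{-1}\ \text{ for } J\subset\{1,\dots,p\},\ |J|\le n,\qquad \pi_J=0\ \text{ if } |J|>n .$$ Then $$\mathbb E\left[\|\hat f_n-f\|_n^2\right]\le\min_{\theta\in\mathbb R^p}\left\{\|f_\theta-f\|_n^2+\frac{\sigma^2|J(\theta)|}{n}\left(4\log\left(\frac{pe}{|J(\theta)|\alpha}\right)+1\right)+\frac{4\sigma^2\log\left(\frac1{1-\alpha}\right)}{n}\right\},$$ where $J(\theta)=\{j:\theta_j\ne0\}$ and the term containing $|J(\theta)|$ is understood as $0$ when $J(\theta)=\emptyset$.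
   Context: For $g:\mathcal X\to\mathbb R$, $\|g\|_n=\left(\frac1n\sum_{i=1}^n g(X_i)^2\right)^{1/2}$. For $\theta\in\mathbb R^p$, $f_\theta=\sum_{j=1}^p\theta_j\phi_j$, and the empirical risk is $r(\theta)=\frac1n\sum_{i=1}^n(Y_i-f_\theta(X_i))^2$. For $J\subset\{1,\dots,p\}$, $|J|$ denotes its cardinality, $\Theta(J)=\{\theta\in\mathbb R^p:\ \theta_j=0\ \text{for all } j\notin J\}$, and $\hat\theta_J\in\arg\min_{\theta\in\Theta(J)}r(\theta)$ is a least squares estimator in the sub-model $J$ (any minimizer; the values $f_{\hat\theta_J}(X_i)$ do not depend on the choice). $\mathcal P_n(\{1,\dots,p\})$ is the set of all subsets of $\{1,\dots,p\}$ with at most $n$ elements. For a temperature $\lambda>0$ and a probability distribution $\pi=(\pi_J)$ on the subsets of $\{1,\dots,p\}$, the aggregate is $\hat f_n=f_{\hat\theta_n}$ with $$\hat\theta_n=\hat\theta_n(\lambda,\pi)=\frac{\sum_{J\in\mathcal P_n(\{1,\dots,p\})}\pi_J\,e^{-\lambda\left(r(\hat\theta_J)+\frac{2\sigma^2|J|}{n}\right)}\,\hat\theta_J}{\sum_{J\in\mathcal P_n(\{1,\dots,p\})}\pi_J\,e^{-\lambda\left(r(\hat\theta_J)+\frac{2\sigma^2|J|}{n}\right)}} .$$ The expectation $\mathbb E$ is with respect to the noise $W_1,\dots,W_n$. *)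

theory Defs
  imports "HOL-Probability.Probability"
begin

text \<open>
  The sample is indexed by a finite type \<open>'n\<close> (so \<open>n = CARD('n)\<close>) and the dictionary by a finite
  type \<open>'p\<close> (so \<open>p = CARD('p)\<close>); sub-models are the sets \<open>J :: 'p set\<close>.
\<close>

definition emp_norm :: "('n::finite \<Rightarrow> 'x) \<Rightarrow> ('x \<Rightarrow> real) \<Rightarrow> real" where
  "emp_norm X g = sqrt ((1 / real CARD('n)) * (\<Sum>i\<in>UNIV. (g (X i))\<^sup>2))"

definition lin_model :: "('p::finite \<Rightarrow> 'x \<Rightarrow> real) \<Rightarrow> real ^ 'p \<Rightarrow> 'x \<Rightarrow> real" where
  "lin_model \<phi> \<theta> x = (\<Sum>j\<in>UNIV. \<theta> $ j * \<phi> j x)"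

definition emp_risk ::
  "('p::finite \<Rightarrow> 'x \<Rightarrow> real) \<Rightarrow> ('n::finite \<Rightarrow> 'x) \<Rightarrow> ('n \<Rightarrow> real) \<Rightarrow> real ^ 'p \<Rightarrow> real" where
  "emp_risk \<phi> X Y \<theta> = (1 / real CARD('n)) * (\<Sum>i\<in>UNIV. (Y i - lin_model \<phi> \<theta> (X i))\<^sup>2)"

definition param_support :: "real ^ 'p \<Rightarrow> 'p set" where
  "param_support \<theta> = {j. \<theta> $ j \<noteq> 0}"

definition submodel :: "'p set \<Rightarrow> (real ^ 'p) set" where
  "submodel J = {\<theta>. \<forall>j. j \<notin> J \<longrightarrow> \<theta> $ j = 0}"

definition is_least_squares ::
  "('p::finite \<Rightarrow> 'x \<Rightarrow> real) \<Rightarrow> ('n::finite \<Rightarrow> 'x) \<Rightarrow> ('n \<Rightarrow> real) \<Rightarrow> 'p set \<Rightarrow> real ^ 'p \<Rightarrow> bool" where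
  "is_least_squares \<phi> X Y J \<theta> \<longleftrightarrow> is_arg_min (emp_risk \<phi> X Y) (\<lambda>\<theta>. \<theta> \<in> submodel J) \<theta>"

definition sparsity_prior :: "nat \<Rightarrow> real \<Rightarrow> 'p::finite set \<Rightarrow> real" where
  "sparsity_prior n \<alpha> J =
     (if card J \<le> n
      then \<alpha> ^ card J / (\<Sum>j=0..n. \<alpha> ^ j) * inverse (real (CARD('p) choose card J))
      else 0)"

text \<open>
  In the following two definitions \<open>\<tau>\<close> is the temperature parameter (usually written as a lambda) and
  \<open>T J\<close> is the least squares estimate in the sub-model \<open>J\<close>, computed
  from the data \<open>Y\<close>.
\<close>

definition exp_weight ::
  "real \<Rightarrow> real \<Rightarrow> ('p::finite set \<Rightarrow> real) \<Rightarrow> ('p \<Rightarrow> 'x \<Rightarrow> real) \<Rightarrow> ('n::finite \<Rightarrow> 'x) \<Rightarrow> ('n \<Rightarrow> real)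
    \<Rightarrow> ('p set \<Rightarrow> real ^ 'p) \<Rightarrow> 'p set \<Rightarrow> real" where
  "exp_weight \<sigma> \<tau> \<pi> \<phi> X Y T J =
     \<pi> J * exp (- \<tau> * (emp_risk \<phi> X Y (T J) + 2 * \<sigma>\<^sup>2 * real (card J) / real CARD('n)))"

definition exp_aggregate ::
  "real \<Rightarrow> real \<Rightarrow> ('p::finite set \<Rightarrow> real) \<Rightarrow> ('p \<Rightarrow> 'x \<Rightarrow> real) \<Rightarrow> ('n::finite \<Rightarrow> 'x) \<Rightarrow> ('n \<Rightarrow> real)
    \<Rightarrow> ('p set \<Rightarrow> real ^ 'p) \<Rightarrow> real ^ 'p" where
  "exp_aggregate \<sigma> \<tau> \<pi> \<phi> X Y T =
     (\<Sum>J | card J \<le> CARD('n). exp_weight \<sigma> \<tau> \<pi> \<phi> X Y T J *\<^sub>R T J) /\<^sub>R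
     (\<Sum>J | card J \<le> CARD('n). exp_weight \<sigma> \<tau> \<pi> \<phi> X Y T J)"

text \<open>
  For \<open>\<theta> = 0\<close> the dimension term is \<open>0\<close> because of the factor \<open>card (param_support \<theta>) = 0\<close>, whatever the
  value of the logarithm.
\<close>

definition oracle_bound ::
  "real \<Rightarrow> real \<Rightarrow> ('p::finite \<Rightarrow> 'x \<Rightarrow> real) \<Rightarrow> ('n::finite \<Rightarrow> 'x) \<Rightarrow> ('x \<Rightarrow> real) \<Rightarrow> real ^ 'p \<Rightarrow> real" where
  "oracle_bound \<sigma> \<alpha> \<phi> X f \<theta> =
     (emp_norm X (\<lambda>x. lin_model \<phi> \<theta> x - f x))\<^sup>2
     + \<sigma>\<^sup>2 * real (card (param_support \<theta>)) / real CARD('n)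
         * (4 * ln (real CARD('p) * exp 1 / (real (card (param_support \<theta>)) * \<alpha>)) + 1)
     + 4 * \<sigma>\<^sup>2 * ln (1 / (1 - \<alpha>)) / real CARD('n)"

end

theory Submission
  imports Defs "HOL-Real_Asymp.Real_Asymp"
begin

text \<open>
  Why the inequality holds. Put \<open>s = \<sigma>\<^sup>2\<close> and view the data as a vector \<open>y = f + w\<close> in \<open>\<real>\<^sup>n\<close>. The
  least squares fit in the sub-model \<open>J\<close> is \<open>P J y\<close>, where \<open>P J\<close> projects orthogonally onto the span of
  the regressors in \<open>J\<close> (\<open>fit_least_squares\<close>). By Pythagoras
  \<open>|y - P J y|\<^sup>2 = |y|\<^sup>2 - y \<bullet> P J y\<close>, and the term \<open>|y|\<^sup>2\<close> cancels from normalized weights, so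
  that at the prescribed temperature the weights are proportional to
  \<open>c J * exp (y \<bullet> P J y / (4 * s))\<close> with constants \<open>c J\<close>. Hence the aggregate equals
  \<open>2 * s\<close> times the gradient of the logarithm of the sum \<open>Z y\<close> of these weights.

  This form makes Stein's unbiased risk estimate of the aggregate explicit: its divergence is
  \<open>2 * s * \<Delta>Z / Z\<close> minus \<open>|aggregate|\<^sup>2 / (2 * s)\<close>, the squared norms cancel, and the estimate is the
  weighted mean of the unbiased risk estimates \<open>|y - P J y|\<^sup>2 + 2 * s * tr (P J)\<close> of the single
  projections (\<open>mixture_unbiased_risk\<close>), up to the constant \<open>n * s\<close>. The temperature \<open>n / (4 * s)\<close> is
  the one for which no variance term is left over. The trace of \<open>P J\<close> is at most \<open>card J\<close>; after this
  replacement, the weights are the Gibbs distribution for the very quantity that is averaged, and the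
  Gibbs variational principle (\<open>gibbs_variational_bound\<close>) bounds the mean by the value at any \<open>K\<close>
  plus \<open>4 * s * ln (1 / \<pi> K)\<close>.

  Everything is compared at one realization of the noise: the loss of the aggregate is at most the
  desired bound plus \<open>w \<bullet> G w - s * div G w\<close> for an explicit vector field \<open>G\<close>
  (\<open>mixture_loss_le\<close>). Gaussian integration by parts (\<open>stein_identity_coordinate\<close>) shows that this
  remainder is integrable with mean zero. The pointwise bound therefore gives integrability of the
  loss together with the bound on its mean (\<open>mixture_risk_le\<close>).

  It remains to choose \<open>K\<close> for a given \<open>\<theta>\<close>. The bound has the leading constant one in front of
  \<open>s * card K\<close> only if the regressors in \<open>K\<close> are linearly independent, since the penalty counts
  \<open>2 * card K\<close> whereas the noise reduction is \<open>tr (P K)\<close>. So \<open>K\<close> is a subset of the support of \<open>\<theta>\<close>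
  whose regressors form a basis of the same span (\<open>free_submodel_exists\<close>); then \<open>card K\<close> is also at
  most \<open>n\<close>, whatever the size of the support. Passing from \<open>K\<close> back to the support is harmless because
  the penalty increases with the dimension (\<open>sparsity_penalty_mono\<close>). The same monotonicity reduces
  the minimum over all \<open>\<theta>\<close> to finitely many candidates, the best approximations in the single
  sub-models (\<open>oracle_bound_attained\<close>).
\<close>

section \<open>Gaussian integration by parts\<close>

lemma le_one_plus_square: "x \<le> 1 + x\<^sup>2" for x :: real
proof -
  have "0 \<le> (x - 1 / 2)\<^sup>2" by simp
  then show ?thesis by (simp add: power2_diff power_divide)
qed

text \<open>
  With \<open>\<gamma>\<close> the density, \<open>\<gamma>' t = - t / \<sigma>\<^sup>2 * \<gamma> t\<close>, so the integrand is the derivative of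
  \<open>- \<sigma>\<^sup>2 * \<gamma> * g\<close>, which vanishes at both ends of the real line.
\<close>
lemma gaussian_integration_by_parts:
  fixes g g' :: "real \<Rightarrow> real"
  assumes \<sigma>: "0 < \<sigma>"
    and deriv: "\<And>t. (g has_real_derivative g' t) (at t)"
    and cont: "continuous_on UNIV g'"
    and g_bound: "\<And>t. \<bar>g t\<bar> \<le> C * (1 + \<bar>t\<bar>)"
    and g'_bound: "\<And>t. \<bar>g' t\<bar> \<le> C * (1 + t\<^sup>2)"
  shows "has_bochner_integral lborel (\<lambda>t. normal_density 0 \<sigma> t * (t * g t - \<sigma>\<^sup>2 * g' t)) 0"
proof -
  define h where "h t = normal_density 0 \<sigma> t * (t * g t - \<sigma>\<^sup>2 * g' t)" for t
  define F where "F t = - \<sigma>\<^sup>2 * (normal_density 0 \<sigma> t * g t)" for t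
  have C: "0 \<le> C" using g_bound[of 0] by auto
  have cont_g: "continuous_on UNIV g"
    using deriv by (intro DERIV_continuous_on) (auto intro: DERIV_subset)
  have dn: "((normal_density 0 \<sigma>) has_real_derivative - (t / \<sigma>\<^sup>2) * normal_density 0 \<sigma> t) (at t)" for t
    unfolding normal_density_def using \<sigma>
    by (auto intro!: derivative_eq_intros simp: field_simps power2_eq_square)
  have cont_n: "continuous_on UNIV (normal_density 0 \<sigma>)"
    using dn by (intro DERIV_continuous_on) (auto intro: DERIV_subset)
  have cont_h: "continuous_on UNIV h"
    unfolding h_def by (intro continuous_intros cont_g cont_n cont)
  have F': "(F has_real_derivative h t) (at t)" for t
  proof -
    have "(F has_real_derivative
        - \<sigma>\<^sup>2 * (- (t / \<sigma>\<^sup>2) * normal_density 0 \<sigma> t * g t + g' t * normal_density 0 \<sigma> t)) (at t)"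
      unfolding F_def by (rule DERIV_cmult[OF DERIV_mult[OF dn deriv]])
    also have "- \<sigma>\<^sup>2 * (- (t / \<sigma>\<^sup>2) * normal_density 0 \<sigma> t * g t + g' t * normal_density 0 \<sigma> t) = h t"
      using \<sigma> by (simp add: h_def field_simps)
    finally show ?thesis .
  qed
  have int_quad: "integrable lborel (\<lambda>t. normal_density 0 \<sigma> t * (1 + t\<^sup>2))"
    using integrable_normal_moment[OF \<sigma>, of 0 2] integrable_normal_density[OF \<sigma>, of 0]
    by (simp add: distrib_left)
  have int_h: "integrable lborel h"
  proof (rule Bochner_Integration.integrable_bound)
    show "integrable lborel (\<lambda>t. (2 * C + \<sigma>\<^sup>2 * C) * (normal_density 0 \<sigma> t * (1 + t\<^sup>2)))"
      using int_quad by simp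
    show "h \<in> borel_measurable lborel"
      using borel_measurable_continuous_onI[OF cont_h] by simp
    have h_bound: "\<bar>h t\<bar> \<le> (2 * C + \<sigma>\<^sup>2 * C) * (normal_density 0 \<sigma> t * (1 + t\<^sup>2))" for t
    proof -
      have "\<bar>t * g t\<bar> \<le> \<bar>t\<bar> * (C * (1 + \<bar>t\<bar>))"
        using g_bound[of t] by (simp add: abs_mult mult_left_mono)
      also have "\<dots> = C * (\<bar>t\<bar> + t\<^sup>2)"
        by (simp add: algebra_simps power2_eq_square)
      also have "\<dots> \<le> C * (2 * (1 + t\<^sup>2))"
        using le_one_plus_square[of "\<bar>t\<bar>"] C by (intro mult_left_mono) auto
      finally have "\<bar>t * g t\<bar> \<le> 2 * C * (1 + t\<^sup>2)" by (simp add: algebra_simps)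
      moreover have "\<bar>\<sigma>\<^sup>2 * g' t\<bar> \<le> \<sigma>\<^sup>2 * C * (1 + t\<^sup>2)"
        using g'_bound[of t] by (simp add: abs_mult mult_left_mono mult.assoc)
      ultimately have "\<bar>t * g t - \<sigma>\<^sup>2 * g' t\<bar> \<le> (2 * C + \<sigma>\<^sup>2 * C) * (1 + t\<^sup>2)"
        by (simp add: distrib_right)
      then have "normal_density 0 \<sigma> t * \<bar>t * g t - \<sigma>\<^sup>2 * g' t\<bar>
          \<le> normal_density 0 \<sigma> t * ((2 * C + \<sigma>\<^sup>2 * C) * (1 + t\<^sup>2))"
        by (rule mult_left_mono) simp
      then show ?thesis by (simp add: h_def abs_mult mult_ac)
    qed
    show "AE t in lborel. norm (h t) \<le> norm ((2 * C + \<sigma>\<^sup>2 * C) * (normal_density 0 \<sigma> t * (1 + t\<^sup>2)))"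
      unfolding real_norm_def by (rule AE_I2) (rule order_trans[OF h_bound abs_ge_self])
  qed
  have F_bound: "\<bar>F t\<bar> \<le> \<sigma>\<^sup>2 * C * (normal_density 0 \<sigma> t * (1 + \<bar>t\<bar>))" for t
    using mult_left_mono[OF g_bound[of t], of "\<sigma>\<^sup>2 * normal_density 0 \<sigma> t"]
    by (simp add: F_def abs_mult mult_ac)
    \<comment> \<open>The Gaussian tail beats the linear growth of \<open>g\<close>.\<close>
  have lim_top: "((\<lambda>t. \<sigma>\<^sup>2 * C * (normal_density 0 \<sigma> t * (1 + \<bar>t\<bar>))) \<longlongrightarrow> 0) at_top"
    unfolding normal_density_def using \<sigma> by real_asymp
  have lim_bot: "((\<lambda>t. \<sigma>\<^sup>2 * C * (normal_density 0 \<sigma> t * (1 + \<bar>t\<bar>))) \<longlongrightarrow> 0) at_bot"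
    unfolding normal_density_def using \<sigma> by real_asymp
  have F_top: "(F \<longlongrightarrow> 0) at_top"
    by (rule Lim_null_comparison[OF _ lim_top]) (simp add: F_bound)
  have F_bot: "(F \<longlongrightarrow> 0) at_bot"
    by (rule Lim_null_comparison[OF _ lim_bot]) (simp add: F_bound)
  have "(LBINT t=-\<infinity>..\<infinity>. h t) = 0 - 0"
  proof (rule interval_integral_FTC_integrable)
    show "(F has_vector_derivative h x) (at x)" for x
      using F' has_real_derivative_iff_has_vector_derivative by blast
    show "isCont h x" for x
      using cont_h continuous_on_eq_continuous_at open_UNIV by blast
    show "set_integrable lborel (einterval (- \<infinity>) \<infinity>) h"
      using int_h by (simp add: einterval_eq_UNIV set_integrable_def)
    show "((F \<circ> real_of_ereal) \<longlongrightarrow> 0) (at_right (- \<infinity>))"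
      using F_bot by (simp add: ereal_tendsto_simps)
    show "((F \<circ> real_of_ereal) \<longlongrightarrow> 0) (at_left \<infinity>)"
      using F_top by (simp add: ereal_tendsto_simps)
  qed simp
  then have "integral\<^sup>L lborel h = 0"
    by (simp add: interval_lebesgue_integral_def einterval_eq_UNIV set_lebesgue_integral_def)
  then show ?thesis
    using int_h unfolding h_def[symmetric] by (simp add: has_bochner_integral_iff)
qed

lemma norm_sq_vec: "(norm w)\<^sup>2 = (\<Sum>j\<in>UNIV. (w $ j)\<^sup>2)" for w :: "real ^ 'n::finite"
  by (simp add: norm_vec_def L2_set_def sum_nonneg)

text \<open>
  Integrating along the \<open>i\<close>-th axis first, with the other coordinates of the noise held fixed,
  leaves a one-dimensional integration by parts. The growth conditions make the integrand at most
  quadratic in the noise, which justifies the use of Fubini's theorem. They are one degree apart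
  because the function is multiplied by a coordinate of the noise, while its derivative is not.
\<close>
lemma stein_identity_coordinate:
  fixes W :: "'n::finite \<Rightarrow> 'w \<Rightarrow> real" and g D :: "real ^ 'n \<Rightarrow> real"
  assumes M: "prob_space M"
    and indep: "prob_space.indep_vars M (\<lambda>_. borel) W UNIV"
    and gauss: "\<And>i. distributed M lborel (W i) (normal_density 0 \<sigma>)"
    and \<sigma>: "0 < \<sigma>"
    and deriv: "\<And>w. ((\<lambda>t. g (w + t *\<^sub>R axis i 1)) has_real_derivative D w) (at 0)"
    and cont_g: "continuous_on UNIV g" and cont_D: "continuous_on UNIV D"
    and g_bound: "\<And>w. \<bar>g w\<bar> \<le> C * (1 + norm w)"
    and D_bound: "\<And>w. \<bar>D w\<bar> \<le> C * (1 + (norm w)\<^sup>2)"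
  shows "has_bochner_integral M (\<lambda>\<omega>. W i \<omega> * g (\<chi> j. W j \<omega>) - \<sigma>\<^sup>2 * D (\<chi> j. W j \<omega>)) 0"
proof -
  interpret prob_space M by (rule M)
  define N where "N = density lborel (normal_density 0 \<sigma>)"
  interpret N: prob_space N unfolding N_def by (rule prob_space_normal_density[OF \<sigma>])
  interpret P: product_sigma_finite "\<lambda>_::'n. N" ..
  interpret P': product_prob_space "\<lambda>_::'n. N" UNIV ..
  have C: "0 \<le> C" using g_bound[of 0] by auto
  have sets_N [simp, measurable_cong]: "sets N = sets borel" by (simp add: N_def)
  have W_meas [measurable]: "W j \<in> borel_measurable M" for j
    using distributed_measurable[OF gauss[of j]] by simp
  have distr_W: "distr M borel (W j) = N" for j
    using distributed_distr_eq_density[OF gauss[of j]]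
    by (simp add: N_def cong: distr_cong)
  have law: "distr M (\<Pi>\<^sub>M j\<in>UNIV. borel) (\<lambda>\<omega>. \<lambda>j\<in>UNIV. W j \<omega>) = (\<Pi>\<^sub>M j\<in>UNIV. N)"
    using indep by (subst (asm) indep_vars_iff_distr_eq_PiM) (simp_all add: distr_W)
  have W_sq: "integrable M (\<lambda>\<omega>. (W j \<omega>)\<^sup>2)" for j
    using distributed_integrable[OF gauss[of j], of "\<lambda>x. x\<^sup>2"] integrable_normal_moment[OF \<sigma>, of 0 2] 
    by simp
  define h where "h w = w $ i * g w - \<sigma>\<^sup>2 * D w" for w
  have cont_h: "continuous_on UNIV h"
    unfolding h_def by (intro continuous_intros cont_g cont_D)
  then have h_meas [measurable]: "h \<in> borel_measurable borel"
    by (rule borel_measurable_continuous_onI)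
  have vec_meas [measurable]: "(\<lambda>\<omega>. \<chi> j. W j \<omega>) \<in> borel_measurable M"
    by (subst borel_measurable_euclidean_space) (auto simp: Basis_vec_def inner_axis)
  have vec_meas' [measurable]: "(\<lambda>x. \<chi> j. x j) \<in> borel_measurable (\<Pi>\<^sub>M j\<in>UNIV. borel :: real measure)"
    by (subst borel_measurable_euclidean_space) (auto simp: Basis_vec_def inner_axis)
  have tuple_meas: "(\<lambda>\<omega>. \<lambda>j\<in>UNIV. W j \<omega>) \<in> measurable M (\<Pi>\<^sub>M j\<in>UNIV. borel)"
    by measurable
  have int_h: "integrable M (\<lambda>\<omega>. h (\<chi> j. W j \<omega>))"
  proof (rule Bochner_Integration.integrable_bound)
    show "integrable M (\<lambda>\<omega>. (2 * C + \<sigma>\<^sup>2 * C) * (1 + (\<Sum>j\<in>UNIV. (W j \<omega>)\<^sup>2)))"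
      using W_sq by simp
    have h_bound: "\<bar>h w\<bar> \<le> (2 * C + \<sigma>\<^sup>2 * C) * (1 + (norm w)\<^sup>2)" for w
    proof -
      have "\<bar>w $ i * g w\<bar> \<le> norm w * (C * (1 + norm w))"
        unfolding abs_mult using g_bound[of w] component_le_norm_cart[of w i]
        by (intro mult_mono) auto
      also have "\<dots> = C * (norm w + (norm w)\<^sup>2)" by (simp add: algebra_simps power2_eq_square)
      also have "\<dots> \<le> C * (2 * (1 + (norm w)\<^sup>2))"
      proof -
        show ?thesis using le_one_plus_square[of "norm w"] C by (intro mult_left_mono) auto
      qed
      finally have "\<bar>w $ i * g w\<bar> \<le> 2 * C * (1 + (norm w)\<^sup>2)" by (simp add: algebra_simps)
      moreover have "\<bar>\<sigma>\<^sup>2 * D w\<bar> \<le> \<sigma>\<^sup>2 * C * (1 + (norm w)\<^sup>2)"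
        using D_bound[of w] by (simp add: abs_mult mult_left_mono mult.assoc)
      ultimately show ?thesis by (simp add: h_def distrib_right)
    qed
    have h_bound': "\<bar>h (\<chi> j. W j \<omega>)\<bar> \<le> (2 * C + \<sigma>\<^sup>2 * C) * (1 + (\<Sum>j\<in>UNIV. (W j \<omega>)\<^sup>2))" for \<omega>
      using h_bound[of "\<chi> j. W j \<omega>"] by (simp add: norm_sq_vec)
    show "AE \<omega> in M. norm (h (\<chi> j. W j \<omega>)) \<le> norm ((2 * C + \<sigma>\<^sup>2 * C) * (1 + (\<Sum>j\<in>UNIV. (W j \<omega>)\<^sup>2)))"
      unfolding real_norm_def by (rule AE_I2) (rule order_trans[OF h_bound' abs_ge_self])
  qed measurable
  have int_Pi: "integrable (\<Pi>\<^sub>M j\<in>UNIV. N) (\<lambda>x. h (\<chi> j. x j))"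
    unfolding law[symmetric] using int_h
    by (subst integrable_distr_eq[OF tuple_meas]) (simp_all add: restrict_def)
    \<comment> \<open>On the line through \<open>v 0\<close> the growth conditions persist, with a constant that depends on \<open>v 0\<close>.\<close>
  have inner: "(\<integral>t. h (\<chi> j. (x(i := t)) j) \<partial>N) = 0" for x
  proof -
    define v where "v t = (\<chi> j. (x(i := t)) j)" for t
    define a where "a = norm (v 0)"
    have a: "0 \<le> a" by (simp add: a_def)
    have v: "v t = v 0 + t *\<^sub>R axis i 1" for t
      by (auto simp: v_def vec_eq_iff axis_def)
    have v_add: "v (t + u) = v t + u *\<^sub>R axis i 1" for t u
      by (auto simp: v_def vec_eq_iff axis_def)
    have norm_v: "norm (v t) \<le> a + \<bar>t\<bar>" for t
      using norm_triangle_ineq[of "v 0" "t *\<^sub>R axis i 1"] by (simp add: a_def v[of t])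
    have "continuous_on UNIV (\<lambda>t. v 0 + t *\<^sub>R axis i 1)"
      by (intro continuous_intros)
    then have cont_v: "continuous_on UNIV v"
      by (simp flip: v)
    let ?C = "C * (3 + a + 2 * a\<^sup>2)"
    have "has_bochner_integral lborel (\<lambda>t. normal_density 0 \<sigma> t * (t * g (v t) - \<sigma>\<^sup>2 * D (v t))) 0"
    proof (rule gaussian_integration_by_parts[OF \<sigma>])
      show "((\<lambda>t. g (v t)) has_real_derivative D (v t)) (at t)" for t
        using deriv[of "v t"] DERIV_shift[of "\<lambda>t. g (v t)" "D (v t)" 0 t]
        unfolding v_add[symmetric] by (simp add: add.commute)
      show "continuous_on UNIV (\<lambda>t. D (v t))"
        by (rule continuous_on_compose2[OF cont_D cont_v]) simp
      show "\<bar>g (v t)\<bar> \<le> ?C * (1 + \<bar>t\<bar>)" for t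
      proof -
        have "\<bar>g (v t)\<bar> \<le> C * (1 + norm (v t))" by (rule g_bound)
        also have "\<dots> \<le> C * ((3 + a + 2 * a\<^sup>2) * (1 + \<bar>t\<bar>))"
        proof (rule mult_left_mono[OF _ C])
          have "0 \<le> (2 * a\<^sup>2 + a + 2) * \<bar>t\<bar>" using a by simp
          then show "1 + norm (v t) \<le> (3 + a + 2 * a\<^sup>2) * (1 + \<bar>t\<bar>)"
            using norm_v[of t] zero_le_power2[of a] unfolding distrib_left distrib_right by linarith
        qed
        finally show ?thesis by (simp add: mult.assoc)
      qed
      show "\<bar>D (v t)\<bar> \<le> ?C * (1 + t\<^sup>2)" for t
      proof -
        have "\<bar>D (v t)\<bar> \<le> C * (1 + (norm (v t))\<^sup>2)" by (rule D_bound)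
        also have "\<dots> \<le> C * ((3 + a + 2 * a\<^sup>2) * (1 + t\<^sup>2))"
        proof (rule mult_left_mono[OF _ C])
          have "(norm (v t))\<^sup>2 \<le> (a + \<bar>t\<bar>)\<^sup>2" using norm_v[of t] by (intro power_mono) auto
          also have "\<dots> \<le> 2 * a\<^sup>2 + 2 * t\<^sup>2"
            using zero_le_power2[of "a - \<bar>t\<bar>"] by (simp add: power2_sum power2_diff)
          finally have "(norm (v t))\<^sup>2 \<le> 2 * a\<^sup>2 + 2 * t\<^sup>2" .
          moreover have "0 \<le> (2 * a\<^sup>2 + a) * t\<^sup>2" using a by simp
          ultimately show "1 + (norm (v t))\<^sup>2 \<le> (3 + a + 2 * a\<^sup>2) * (1 + t\<^sup>2)"
            using a zero_le_power2[of t] unfolding distrib_left distrib_right by linarith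
        qed
        finally show ?thesis by (simp add: mult.assoc)
      qed
    qed
    moreover have "h (v t) = t * g (v t) - \<sigma>\<^sup>2 * D (v t)" for t
      by (simp add: h_def v_def)
    ultimately have "has_bochner_integral lborel (\<lambda>t. normal_density 0 \<sigma> t *\<^sub>R h (v t)) 0" by simp
    moreover have "(\<lambda>t. h (v t)) \<in> borel_measurable lborel"
      using continuous_on_compose2[OF cont_h cont_v] by (simp add: borel_measurable_continuous_onI)
    ultimately have "has_bochner_integral N (\<lambda>t. h (v t)) 0"
      unfolding N_def by (intro has_bochner_integral_density) auto
    then show ?thesis unfolding v_def by (rule has_bochner_integral_integral_eq)
  qed
  have "(\<integral>\<omega>. h (\<chi> j. W j \<omega>) \<partial>M) = (\<integral>x. h (\<chi> j. x j) \<partial>(\<Pi>\<^sub>M j\<in>UNIV. N))"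
    unfolding law[symmetric] by (subst integral_distr[OF tuple_meas]) (simp_all add: restrict_def)
  also have "\<dots> = (\<integral>x. h (\<chi> j. x j) \<partial>(\<Pi>\<^sub>M j\<in>insert i (UNIV - {i}). N))"
    by (simp add: insert_absorb)
  also have "\<dots> = (\<integral>x. (\<integral>t. h (\<chi> j. (x(i := t)) j) \<partial>N) \<partial>(\<Pi>\<^sub>M j\<in>UNIV - {i}. N))"
    using int_Pi by (intro P.product_integral_insert) (simp_all add: insert_absorb)
  also have "\<dots> = 0" by (simp only: inner) simp
  finally show ?thesis
    using int_h by (simp add: has_bochner_integral_iff h_def)
qed

section \<open>Orthogonal projections\<close>

text \<open>
  Self-adjoint idempotents are the orthogonal projections onto their range. The algebraic form is
  convenient because the mixture below uses only linearity, symmetry and idempotence.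
\<close>
definition orth_projection :: "('a::euclidean_space \<Rightarrow> 'a) \<Rightarrow> bool" where
  "orth_projection P \<longleftrightarrow> linear P \<and> (\<forall>x y. P x \<bullet> y = x \<bullet> P y) \<and> (\<forall>x. P (P x) = P x)"

text \<open>
  Expanding along an orthonormal basis \<open>B\<close> gives the projection. Its trace is the sum over \<open>B\<close> of the
  squared norms of the basis vectors, by Parseval's identity, hence the dimension.
\<close>
lemma orth_projection_exists:
  fixes S :: "'a::euclidean_space set"
  assumes "subspace S"
  shows "\<exists>P. orth_projection P \<and> range P = S \<and> (\<Sum>b\<in>Basis. P b \<bullet> b) = dim S"
proof -
  obtain B where B: "B \<subseteq> S" "pairwise orthogonal B" "\<And>x. x \<in> B \<Longrightarrow> norm x = 1"
      "independent B" "card B = dim S" "span B = S"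
    using orthonormal_basis_subspace[OF assms] by metis
  have fin: "finite B" using B(4) by (rule independent_imp_finite)
  define P where "P y = (\<Sum>b\<in>B. (y \<bullet> b) *\<^sub>R b)" for y
  have lin: "linear P"
    unfolding P_def by (rule linearI)
      (simp_all add: inner_add_left scaleR_add_left sum.distrib scaleR_sum_right)
  have P_basis: "P b = b" if "b \<in> B" for b
  proof -
    have "P b = (\<Sum>c\<in>B. if c = b then b else 0)"
      unfolding P_def
    proof (rule sum.cong[OF refl])
      fix c assume c: "c \<in> B"
      show "(b \<bullet> c) *\<^sub>R c = (if c = b then b else 0)"
        using B(2) B(3)[OF that] c that
        by (auto simp: pairwise_def orthogonal_def norm_eq_1)
    qed
    then show ?thesis using that fin by simp
  qed
  have "P x \<bullet> y = x \<bullet> P y" for x y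
    by (simp add: P_def inner_sum_left inner_sum_right inner_commute mult.commute)
  moreover have idem: "P x = x" if "x \<in> span B" for x
    using linear_eq_on[OF lin linear_id that] P_basis by simp
  moreover have range: "P x \<in> span B" for x
    unfolding P_def by (intro span_sum span_scale span_base)
  moreover have "range P = S"
    using range idem B(6) by (metis image_subset_iff rangeI subsetI subset_antisym)
  moreover have "(\<Sum>b\<in>Basis. P b \<bullet> b) = dim S"
  proof -
    have "(\<Sum>b\<in>Basis. P b \<bullet> b) = (\<Sum>b\<in>Basis. \<Sum>c\<in>B. (b \<bullet> c) * (b \<bullet> c))"
      by (simp add: P_def inner_sum_left) (simp add: inner_commute)
    also have "\<dots> = (\<Sum>c\<in>B. \<Sum>b\<in>Basis. (c \<bullet> b) * (c \<bullet> b))"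
      by (subst sum.swap) (simp add: inner_commute)
    also have "\<dots> = (\<Sum>c\<in>B. 1)"
      using B(3) by (intro sum.cong refl) (simp add: euclidean_inner[symmetric] norm_eq_1)
    finally show ?thesis using B(5) by simp
  qed
  ultimately show ?thesis
    using lin unfolding orth_projection_def by blast
qed

lemma
  assumes "orth_projection P"
  shows orth_projection_linear: "linear P"
    and orth_projection_symmetric: "P x \<bullet> y = x \<bullet> P y"
    and orth_projection_idem: "P (P x) = P x"
  using assms by (auto simp: orth_projection_def)

lemma inner_orth_projection:
  assumes "orth_projection P"
  shows "x \<bullet> P x = (norm (P x))\<^sup>2"
  by (metis assms orth_projection_symmetric orth_projection_idem power2_norm_eq_inner)

lemma norm_sq_residual:
  assumes "orth_projection P"
  shows "(norm (x - P x))\<^sup>2 = (norm x)\<^sup>2 - (norm (P x))\<^sup>2"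
  using inner_orth_projection[OF assms, of x]
  by (simp add: power2_norm_eq_inner inner_diff inner_commute)

lemma norm_orth_projection_le:
  assumes "orth_projection P"
  shows "norm (P x) \<le> norm x"
  using norm_sq_residual[OF assms, of x] zero_le_power2[of "norm (x - P x)"]
  by (intro power2_le_imp_le[of "norm (P x)"]) auto

lemma orth_projection_pythagoras:
  assumes P: "orth_projection P" and z: "z \<in> range P"
  shows "(norm (y - z))\<^sup>2 = (norm (y - P y))\<^sup>2 + (norm (P y - z))\<^sup>2"
proof -
  obtain x where x: "z = P x" using z by blast
  have "(y - P y) \<bullet> (P y - z) = (y - P y) \<bullet> P (y - x)"
    by (simp add: x linear_diff[OF orth_projection_linear[OF P]])
  also have "\<dots> = P (y - P y) \<bullet> (y - x)"
    by (rule orth_projection_symmetric[OF P, symmetric])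
  also have "\<dots> = 0"
    by (simp add: linear_diff[OF orth_projection_linear[OF P]] orth_projection_idem[OF P])
  finally have orth: "orthogonal (y - P y) (P y - z)" by (simp add: orthogonal_def)
  have "y - z = (y - P y) + (P y - z)" by simp
  then show ?thesis using norm_add_Pythagorean[OF orth] by simp
qed

lemma orth_projection_minimal:
  assumes P: "orth_projection P" and z: "z \<in> range P"
  shows "norm (y - P y) \<le> norm (y - z)"
  using orth_projection_pythagoras[OF P z, of y] by (intro power2_le_imp_le[of "norm (y - P y)"]) auto

lemma minimal_distance_imp_orth_projection:
  assumes P: "orth_projection P" and z: "z \<in> range P"
    and min: "norm (y - z) \<le> norm (y - P y)"
  shows "z = P y"
proof -
  have "(norm (P y - z))\<^sup>2 \<le> 0"
    using orth_projection_pythagoras[OF P z, of y] power_mono[OF min, of 2] by simp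
  then show ?thesis by simp
qed

lemma sum_Basis_vec:
  fixes g :: "real ^ 'n::finite \<Rightarrow> real"
  shows "(\<Sum>b\<in>Basis. g b) = (\<Sum>i\<in>UNIV. g (axis i 1))"
proof -
  have basis: "(Basis :: (real ^ 'n) set) = range (\<lambda>i. axis i 1)"
    by (auto simp: Basis_vec_def)
  have inj: "inj (\<lambda>i :: 'n. axis i (1::real))"
    by (auto simp: inj_on_def axis_eq_axis)
  show ?thesis unfolding basis by (simp add: sum.reindex[OF inj])
qed

section \<open>Exponentially weighted mixtures of projections\<close>

text \<open>
  The mixture of the projections \<open>P J y\<close> with weights proportional to
  \<open>c J * exp (y \<bullet> P J y / (4 * s))\<close>. A factor of the weights that depends on \<open>y\<close> but not on \<open>J\<close> has
  been dropped, so that the derivative of a weight involves \<open>P J y\<close> only.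
\<close>
locale projection_mixture =
  fixes A :: "'j set" and P :: "'j \<Rightarrow> real ^ 'n::finite \<Rightarrow> real ^ 'n" and c :: "'j \<Rightarrow> real" and s :: real
  assumes finite_A: "finite A" and A_nonempty: "A \<noteq> {}"
    and proj: "\<And>J. J \<in> A \<Longrightarrow> orth_projection (P J)"
    and c_pos: "\<And>J. J \<in> A \<Longrightarrow> 0 < c J"
    and s_pos: "0 < s"
begin

definition weight :: "'j \<Rightarrow> real ^ 'n \<Rightarrow> real" where
  "weight J y = c J * exp (y \<bullet> P J y / (4 * s))"

definition normalizer :: "real ^ 'n \<Rightarrow> real" where
  "normalizer y = (\<Sum>J\<in>A. weight J y)"

definition mean :: "('j \<Rightarrow> real) \<Rightarrow> real ^ 'n \<Rightarrow> real" where
  "mean q y = (\<Sum>J\<in>A. weight J y * q J) / normalizer y"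

definition mixture :: "real ^ 'n \<Rightarrow> real ^ 'n" where
  "mixture y = (\<Sum>J\<in>A. weight J y *\<^sub>R P J y) /\<^sub>R normalizer y"

text \<open>
  The partial derivative of the \<open>i\<close>-th coordinate of the mixture in the direction \<open>i\<close>. With
  \<open>Z\<close> the normalizer it is \<open>2 * s\<close> times the second logarithmic derivative of \<open>Z\<close>, which is why the
  square of the mean is subtracted.
\<close>
definition mixture_deriv :: "'n \<Rightarrow> real ^ 'n \<Rightarrow> real" where
  "mixture_deriv i y =
     mean (\<lambda>J. (P J y $ i)\<^sup>2 / (2 * s) + P J (axis i 1) $ i) y - (mixture y $ i)\<^sup>2 / (2 * s)"

lemma weight_pos: "J \<in> A \<Longrightarrow> 0 < weight J y"
  by (simp add: weight_def c_pos)

lemma normalizer_pos: "0 < normalizer y"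
  unfolding normalizer_def using finite_A A_nonempty weight_pos by (intro sum_pos) auto

lemma mixture_nth: "mixture y $ i = mean (\<lambda>J. P J y $ i) y"
  by (simp add: mixture_def mean_def divide_inverse mult.commute)

lemma mean_mono: "(\<And>J. J \<in> A \<Longrightarrow> q J \<le> r J) \<Longrightarrow> mean q y \<le> mean r y"
  unfolding mean_def using normalizer_pos weight_pos
  by (intro divide_right_mono sum_mono mult_left_mono) (auto intro: less_imp_le)

lemma mean_const: "mean (\<lambda>_. a) y = a"
  using normalizer_pos[of y] by (simp add: mean_def normalizer_def flip: sum_distrib_right)

lemma mean_add: "mean (\<lambda>J. q J + r J) y = mean q y + mean r y"
  by (simp add: mean_def distrib_left sum.distrib add_divide_distrib)

lemma mean_mult_left: "mean (\<lambda>J. a * q J) y = a * mean q y"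
  by (simp add: mean_def sum_distrib_left mult_ac)

lemma mean_sum: "mean (\<lambda>J. \<Sum>i\<in>I. q i J) y = (\<Sum>i\<in>I. mean (q i) y)"
  by (simp add: mean_def sum_distrib_left sum_divide_distrib) (rule sum.swap)

lemma mean_abs_le:
  assumes "\<And>J. J \<in> A \<Longrightarrow> \<bar>q J\<bar> \<le> a"
  shows "\<bar>mean q y\<bar> \<le> a"
proof (rule abs_leI)
  show "mean q y \<le> a"
    using mean_mono[of q "\<lambda>_. a" y] assms by (force simp: mean_const)
  have "mean (\<lambda>_. - a) y \<le> mean q y"
    using assms by (intro mean_mono) force
  then show "- mean q y \<le> a" by (simp add: mean_const)
qed

lemma cont_proj: "J \<in> A \<Longrightarrow> continuous_on UNIV (P J)"
  using linear_continuous_on linear_conv_bounded_linear orth_projection_linear proj by blast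

lemma cont_weight: "J \<in> A \<Longrightarrow> continuous_on UNIV (weight J)"
  unfolding weight_def using s_pos by (intro continuous_intros cont_proj) auto

lemma cont_mean:
  assumes "\<And>J. J \<in> A \<Longrightarrow> continuous_on UNIV (q J)"
  shows "continuous_on UNIV (\<lambda>y. mean (\<lambda>J. q J y) y)"
  unfolding mean_def normalizer_def using normalizer_pos assms
  by (intro continuous_intros cont_weight) (auto simp: normalizer_def order_less_le)

lemma cont_mixture_nth: "continuous_on UNIV (\<lambda>y. mixture y $ i)"
  unfolding mixture_nth by (intro cont_mean continuous_intros cont_proj)

lemma cont_mixture_deriv: "continuous_on UNIV (mixture_deriv i)"
  unfolding mixture_deriv_def[abs_def] using s_pos
  by (intro continuous_intros cont_mean cont_mixture_nth cont_proj) auto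

lemma proj_nth_le: "J \<in> A \<Longrightarrow> \<bar>P J y $ i\<bar> \<le> norm y"
  using component_le_norm_cart[of "P J y" i] norm_orth_projection_le[OF proj, of J y] by linarith

lemma mixture_nth_bound: "\<bar>mixture y $ i\<bar> \<le> norm y"
  unfolding mixture_nth by (rule mean_abs_le) (rule proj_nth_le)

lemma mixture_deriv_bound: "\<bar>mixture_deriv i y\<bar> \<le> 1 + (norm y)\<^sup>2 / s"
proof -
  have sq: "x\<^sup>2 / (2 * s) \<le> (norm y)\<^sup>2 / (2 * s)" if "\<bar>x\<bar> \<le> norm y" for x
    using s_pos power_mono[OF that, of 2] by (simp add: divide_right_mono)
  have "\<bar>mean (\<lambda>J. (P J y $ i)\<^sup>2 / (2 * s) + P J (axis i 1) $ i) y\<bar> \<le> (norm y)\<^sup>2 / (2 * s) + 1"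
  proof (rule mean_abs_le)
    fix J assume J: "J \<in> A"
    have "\<bar>P J (axis i 1) $ i\<bar> \<le> 1" using proj_nth_le[OF J, of "axis i 1" i] by simp
    moreover have "0 \<le> (P J y $ i)\<^sup>2 / (2 * s)" using s_pos by simp
    ultimately show "\<bar>(P J y $ i)\<^sup>2 / (2 * s) + P J (axis i 1) $ i\<bar> \<le> (norm y)\<^sup>2 / (2 * s) + 1"
      using sq[OF proj_nth_le[OF J, of y i]] by linarith
  qed
  moreover have "0 \<le> (mixture y $ i)\<^sup>2 / (2 * s)" using s_pos by simp
  moreover have "(norm y)\<^sup>2 / (2 * s) + (norm y)\<^sup>2 / (2 * s) = (norm y)\<^sup>2 / s" using s_pos by simp
  ultimately show ?thesis
    using sq[OF mixture_nth_bound[of y i]] unfolding mixture_deriv_def by linarith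
qed

text \<open>
  Along a line the quadratic form \<open>y \<bullet> P J y\<close> is a quadratic polynomial whose linear coefficient is
  twice a coordinate of \<open>P J y\<close>, by symmetry of \<open>P J\<close>. The normalizer therefore has the
  numerator of the mixture, divided by \<open>2 * s\<close>, as its derivative.
\<close>
lemma weight_has_deriv:
  assumes J: "J \<in> A"
  shows "((\<lambda>t. weight J (y + t *\<^sub>R axis i 1)) has_real_derivative
          weight J y * (P J y $ i / (2 * s))) (at 0)"
proof -
  note lin = orth_projection_linear[OF proj[OF J]]
  define a where "a = axis i (1::real)"
  have quad: "(y + t *\<^sub>R a) \<bullet> P J (y + t *\<^sub>R a) = y \<bullet> P J y + 2 * t * (P J y $ i) + t\<^sup>2 * (a \<bullet> P J a)" for t
  proof -
    have "y \<bullet> P J a = P J y $ i"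
      using orth_projection_symmetric[OF proj[OF J], of y a] by (simp add: a_def inner_axis)
    moreover have "a \<bullet> P J y = P J y $ i" by (simp add: a_def inner_axis' )
    ultimately show ?thesis
      by (simp add: linear_add[OF lin] linear_scale[OF lin] inner_add_left inner_add_right
          algebra_simps power2_eq_square)
  qed
  show ?thesis
    unfolding weight_def a_def[symmetric] quad using s_pos
    by (auto intro!: derivative_eq_intros simp: field_simps)
qed

lemma proj_has_deriv:
  assumes J: "J \<in> A"
  shows "((\<lambda>t. P J (y + t *\<^sub>R axis i 1) $ i) has_real_derivative P J (axis i 1) $ i) (at 0)"
proof -
  note lin = orth_projection_linear[OF proj[OF J]]
  show ?thesis
    by (auto simp: linear_add[OF lin] linear_scale[OF lin] intro!: derivative_eq_intros)
qed

lemma mixture_has_deriv: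
  "((\<lambda>t. mixture (y + t *\<^sub>R axis i 1) $ i) has_real_derivative mixture_deriv i y) (at 0)"
proof -
  let ?N = "\<lambda>y. \<Sum>J\<in>A. weight J y * P J y $ i"
  have Z: "((\<lambda>t. normalizer (y + t *\<^sub>R axis i 1)) has_real_derivative ?N y / (2 * s)) (at 0)"
    unfolding normalizer_def sum_divide_distrib times_divide_eq_right[symmetric]
    by (intro DERIV_sum) (use weight_has_deriv in auto)
  have N: "((\<lambda>t. ?N (y + t *\<^sub>R axis i 1)) has_real_derivative
      (\<Sum>J\<in>A. weight J y * ((P J y $ i)\<^sup>2 / (2 * s) + P J (axis i 1) $ i))) (at 0)"
  proof (rule DERIV_sum)
    fix J assume J: "J \<in> A"
    show "((\<lambda>t. weight J (y + t *\<^sub>R axis i 1) * P J (y + t *\<^sub>R axis i 1) $ i) has_real_derivative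
        weight J y * ((P J y $ i)\<^sup>2 / (2 * s) + P J (axis i 1) $ i)) (at 0)"
      using DERIV_mult[OF weight_has_deriv[OF J] proj_has_deriv[OF J], of y i y i]
      by (simp add: algebra_simps power2_eq_square)
  qed
  have "((\<lambda>t. ?N (y + t *\<^sub>R axis i 1) / normalizer (y + t *\<^sub>R axis i 1)) has_real_derivative
      mixture_deriv i y) (at 0)"
  proof (rule DERIV_cong[OF DERIV_divide[OF N Z]])
    show "normalizer (y + 0 *\<^sub>R axis i 1) \<noteq> 0" using normalizer_pos[of y] by simp
  next
    let ?a = "\<Sum>J\<in>A. weight J y * ((P J y $ i)\<^sup>2 / (2 * s) + P J (axis i 1) $ i)"
    have "mixture_deriv i y = ?a / normalizer y - (?N y / normalizer y)\<^sup>2 / (2 * s)"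
      by (simp add: mixture_deriv_def mean_def mixture_nth)
    also have "\<dots> = (?a * normalizer y - ?N y * (?N y / (2 * s))) / (normalizer y * normalizer y)"
      using normalizer_pos[of y] s_pos by (simp add: power2_eq_square field_simps)
    finally show "(?a * normalizer (y + 0 *\<^sub>R axis i 1) - ?N (y + 0 *\<^sub>R axis i 1) * (?N y / (2 * s)))
        / (normalizer (y + 0 *\<^sub>R axis i 1) * normalizer (y + 0 *\<^sub>R axis i 1)) = mixture_deriv i y"
      by simp
  qed
  then show ?thesis by (simp add: mixture_nth mean_def)
qed

lemma inner_mixture: "x \<bullet> mixture y = mean (\<lambda>J. x \<bullet> P J y) y"
  by (simp add: mixture_def mean_def inner_sum_right divide_inverse mult_ac)

text \<open>
  The left-hand side is, up to a constant, Stein's unbiased estimate of the risk of the mixture.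
  The divergence contains \<open>- |mixture y|\<^sup>2 / (2 * s)\<close>, and multiplication by \<open>2 * s\<close> makes it cancel
  the squared norm in the expansion of \<open>|y - mixture y|\<^sup>2\<close>. What is left is affine in the
  weights.
\<close>
lemma mixture_unbiased_risk:
  "(norm (y - mixture y))\<^sup>2 + 2 * s * (\<Sum>i\<in>UNIV. mixture_deriv i y)
   = mean (\<lambda>J. (norm (y - P J y))\<^sup>2 + 2 * s * (\<Sum>i\<in>UNIV. P J (axis i 1) $ i)) y"
proof -
  have "2 * s * (\<Sum>i\<in>UNIV. mixture_deriv i y)
      = 2 * s * mean (\<lambda>J. \<Sum>i\<in>UNIV. (P J y $ i)\<^sup>2 / (2 * s) + P J (axis i 1) $ i) y - (norm (mixture y))\<^sup>2"
    using s_pos by (simp add: mixture_deriv_def sum_subtractf mean_sum norm_vec_def L2_set_def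
        sum_nonneg right_diff_distrib sum_distrib_left)
  also have "\<dots> = mean (\<lambda>J. (norm (P J y))\<^sup>2 + 2 * s * (\<Sum>i\<in>UNIV. P J (axis i 1) $ i)) y
      - (norm (mixture y))\<^sup>2"
    using s_pos by (simp add: mean_mult_left[symmetric] sum.distrib norm_vec_def L2_set_def
        sum_nonneg distrib_left sum_distrib_left)
  finally have div: "2 * s * (\<Sum>i\<in>UNIV. mixture_deriv i y) = \<dots>" .
  have "(norm (y - mixture y))\<^sup>2 = (norm y)\<^sup>2 - 2 * (y \<bullet> mixture y) + (norm (mixture y))\<^sup>2"
    by (simp add: power2_norm_eq_inner inner_diff inner_commute)
  then have "(norm (y - mixture y))\<^sup>2 + 2 * s * (\<Sum>i\<in>UNIV. mixture_deriv i y)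
      = (norm y)\<^sup>2 + (- 2) * (y \<bullet> mixture y)
        + mean (\<lambda>J. (norm (P J y))\<^sup>2 + 2 * s * (\<Sum>i\<in>UNIV. P J (axis i 1) $ i)) y"
    using div by simp
  also have "\<dots> = mean (\<lambda>J. (norm y)\<^sup>2 + (- 2) * (y \<bullet> P J y)
        + ((norm (P J y))\<^sup>2 + 2 * s * (\<Sum>i\<in>UNIV. P J (axis i 1) $ i))) y"
    by (simp only: mean_add mean_const mean_mult_left inner_mixture)
  also have "\<dots> = mean (\<lambda>J. (norm (y - P J y))\<^sup>2 + 2 * s * (\<Sum>i\<in>UNIV. P J (axis i 1) $ i)) y"
    unfolding mean_def
    by (intro arg_cong2[where f = "(/)"] sum.cong refl)
      (simp add: norm_sq_residual[OF proj] inner_orth_projection[OF proj])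
  finally show ?thesis .
qed

end

section \<open>Risk of a penalized mixture\<close>

text \<open>
  The weights \<open>w\<close> minimize the mean of \<open>Q\<close> plus \<open>\<beta>\<close> times the relative entropy with respect to \<open>\<pi>\<close>,
  with minimum \<open>- \<beta> * ln Z\<close>. Nonnegativity of the entropy, in the form \<open>x \<le> exp x - 1\<close>, bounds the
  mean of \<open>Q\<close> by \<open>- \<beta> * ln Z\<close>, and keeping the single term \<open>K\<close> of the sum \<open>Z\<close> gives the claim.
\<close>
lemma gibbs_variational_bound:
  fixes \<pi> Q :: "'j \<Rightarrow> real"
  assumes fin: "finite A" and K: "K \<in> A" and pos: "\<And>J. J \<in> A \<Longrightarrow> 0 < \<pi> J"
    and mass: "(\<Sum>J\<in>A. \<pi> J) \<le> 1" and \<beta>: "0 < \<beta>"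
  shows "(\<Sum>J\<in>A. \<pi> J * exp (- (Q J / \<beta>)) * Q J) / (\<Sum>J\<in>A. \<pi> J * exp (- (Q J / \<beta>)))
         \<le> Q K + \<beta> * ln (1 / \<pi> K)"
proof -
  define Z where "Z = (\<Sum>J\<in>A. \<pi> J * exp (- (Q J / \<beta>)))"
  define w where "w J = \<pi> J * exp (- (Q J / \<beta>)) / Z" for J
  have Z: "0 < Z" unfolding Z_def using fin K pos by (intro sum_pos) auto
  have w_sum: "(\<Sum>J\<in>A. w J) = 1"
    unfolding w_def sum_divide_distrib[symmetric] Z_def[symmetric] using Z by simp
  have w_pos: "0 < w J" if "J \<in> A" for J using pos[OF that] Z by (simp add: w_def)
  have step: "w J * (Q J / \<beta> + ln Z) \<le> \<pi> J - w J" if J: "J \<in> A" for J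
  proof -
    have ratio: "\<pi> J / w J = exp (Q J / \<beta> + ln Z)"
      using pos[OF J] Z by (simp add: w_def exp_add exp_minus field_simps)
    have "Q J / \<beta> + ln Z \<le> \<pi> J / w J - 1"
      unfolding ratio using exp_ge_add_one_self[of "Q J / \<beta> + ln Z"] by linarith
    then have "w J * (Q J / \<beta> + ln Z) \<le> w J * (\<pi> J / w J - 1)"
      using w_pos[OF J] by (intro mult_left_mono) auto
    then show ?thesis using w_pos[OF J] by (simp add: right_diff_distrib)
  qed
  have "(\<Sum>J\<in>A. w J * Q J) / \<beta> + ln Z = (\<Sum>J\<in>A. w J * (Q J / \<beta> + ln Z))"
    using w_sum by (simp add: distrib_left sum.distrib sum_divide_distrib flip: sum_distrib_right)
  also have "\<dots> \<le> (\<Sum>J\<in>A. \<pi> J - w J)"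
    by (intro sum_mono step)
  also have "\<dots> \<le> 0" using mass w_sum by (simp add: sum_subtractf)
  finally have *: "(\<Sum>J\<in>A. w J * Q J) / \<beta> \<le> - ln Z" by simp
  have "\<pi> K * exp (- (Q K / \<beta>)) \<le> Z"
    unfolding Z_def using fin K pos by (intro member_le_sum) (auto intro: less_imp_le)
  then have "ln (\<pi> K * exp (- (Q K / \<beta>))) \<le> ln Z"
    using pos[OF K] Z by simp
  then have "ln (\<pi> K) - Q K / \<beta> \<le> ln Z"
    using pos[OF K] by (simp add: ln_mult)
  with * have "(\<Sum>J\<in>A. w J * Q J) / \<beta> \<le> Q K / \<beta> + ln (1 / \<pi> K)"
    using pos[OF K] by (simp add: ln_div)
  then have "(\<Sum>J\<in>A. w J * Q J) \<le> (Q K / \<beta> + ln (1 / \<pi> K)) * \<beta>"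
    using \<beta> by (simp add: pos_divide_le_eq)
  also have "\<dots> = Q K + \<beta> * ln (1 / \<pi> K)" using \<beta> by (simp add: algebra_simps)
  finally show ?thesis unfolding w_def times_divide_eq_left sum_divide_distrib[symmetric] Z_def .
qed

text \<open>
  Here \<open>k J\<close> is the nominal dimension of the sub-model \<open>J\<close>. The factor \<open>exp (- (k J / 2))\<close> is the
  penalty \<open>2 * s * k J\<close> at inverse temperature \<open>1 / (4 * s)\<close>.
\<close>
locale penalized_projection_mixture = projection_mixture A P "\<lambda>J. \<pi> J * exp (- (k J / 2))" s
  for A :: "'j set" and P :: "'j \<Rightarrow> real ^ 'n::finite \<Rightarrow> real ^ 'n"
    and \<pi> k :: "'j \<Rightarrow> real" and s :: real +
  assumes mass: "(\<Sum>J\<in>A. \<pi> J) \<le> 1"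
    and trace_le: "\<And>J. J \<in> A \<Longrightarrow> (\<Sum>i\<in>UNIV. P J (axis i 1) $ i) \<le> k J"
begin

definition penalized_loss :: "real ^ 'n \<Rightarrow> 'j \<Rightarrow> real" where
  "penalized_loss y J = (norm (y - P J y))\<^sup>2 + 2 * s * k J"

lemma prior_pos: "J \<in> A \<Longrightarrow> 0 < \<pi> J"
  using c_pos[of J] by (simp add: zero_less_mult_iff)

lemma weight_eq:
  assumes "J \<in> A"
  shows "weight J y = exp ((norm y)\<^sup>2 / (4 * s)) * (\<pi> J * exp (- (penalized_loss y J / (4 * s))))"
proof -
  have "- (k J / 2) + y \<bullet> P J y / (4 * s) = (norm y)\<^sup>2 / (4 * s) + - (penalized_loss y J / (4 * s))"
    using s_pos norm_sq_residual[OF proj[OF assms], of y] inner_orth_projection[OF proj[OF assms], of y]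
    by (simp add: penalized_loss_def field_simps)
  then show ?thesis
    unfolding weight_def mult.assoc mult.left_commute[of "exp _" "\<pi> J"] exp_add[symmetric] by simp
qed

text \<open>
  The mixture weights are the Gibbs weights of the penalized loss: the two differ by the factor
  \<open>exp (|y|\<^sup>2 / (4 * s))\<close>, which does not depend on \<open>J\<close> and cancels in the quotient.
\<close>
lemma mean_penalized_loss:
  "mean q y = (\<Sum>J\<in>A. \<pi> J * exp (- (penalized_loss y J / (4 * s))) * q J)
            / (\<Sum>J\<in>A. \<pi> J * exp (- (penalized_loss y J / (4 * s))))"
proof -
  have "(\<Sum>J\<in>A. weight J y * q J) = exp ((norm y)\<^sup>2 / (4 * s)) *
      (\<Sum>J\<in>A. \<pi> J * exp (- (penalized_loss y J / (4 * s))) * q J)" for q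
    unfolding sum_distrib_left by (intro sum.cong refl) (simp add: weight_eq)
  from this[of q] this[of "\<lambda>_. 1"] show ?thesis by (simp add: mean_def normalizer_def)
qed

lemma mean_penalized_loss_le:
  assumes K: "K \<in> A"
  shows "mean (penalized_loss y) y \<le> penalized_loss y K + 4 * s * ln (1 / \<pi> K)"
  unfolding mean_penalized_loss
  using gibbs_variational_bound[OF finite_A K prior_pos mass, of "4 * s" "penalized_loss y"] s_pos
  by simp

text \<open>
  The last sum is \<open>w \<bullet> G w - s * div G w\<close> for the field
  \<open>G w = 2 * mixture (f + w) - 2 * P K f - P K w\<close>. It collects everything on the right that depends
  on the noise: the first summand of \<open>G\<close> comes from Stein's identity for the mixture, and the others
  turn the residual \<open>|y - P K y|\<^sup>2\<close> into \<open>|f - P K f|\<^sup>2\<close>.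
\<close>
lemma mixture_loss_le:
  assumes K: "K \<in> A"
  shows "(norm (mixture (f + w) - f))\<^sup>2
    \<le> (norm (f - P K f))\<^sup>2 + s * (2 * k K - (\<Sum>i\<in>UNIV. P K (axis i 1) $ i)) + 4 * s * ln (1 / \<pi> K)
      + (\<Sum>i\<in>UNIV. w $ i * (2 * mixture (f + w) $ i - 2 * P K f $ i - P K w $ i)
          - s * (2 * mixture_deriv i (f + w) - P K (axis i 1) $ i))"
proof -
  define y where "y = f + w"
  define d where "d = (\<Sum>i\<in>UNIV. P K (axis i 1) $ i)"
  define S where "S = (\<Sum>i\<in>UNIV. mixture_deriv i y)"
  note PK = proj[OF K]
  have noise: "(\<Sum>i\<in>UNIV. w $ i * (2 * mixture y $ i - 2 * P K f $ i - P K w $ i)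
          - s * (2 * mixture_deriv i y - P K (axis i 1) $ i))
      = 2 * (w \<bullet> mixture y) - 2 * (w \<bullet> P K f) - w \<bullet> P K w - 2 * s * S + s * d"
    by (simp add: inner_vec_def d_def S_def sum_subtractf sum_distrib_left algebra_simps sum.distrib)
  have "(norm (y - mixture y))\<^sup>2 + 2 * s * S \<le> mean (penalized_loss y) y"
    unfolding S_def mixture_unbiased_risk penalized_loss_def
    using s_pos trace_le by (intro mean_mono) simp
  also have "\<dots> \<le> penalized_loss y K + 4 * s * ln (1 / \<pi> K)"
    by (rule mean_penalized_loss_le[OF K])
  finally have sure: "(norm (y - mixture y))\<^sup>2 + 2 * s * S
      \<le> (norm (y - P K y))\<^sup>2 + 2 * s * k K + 4 * s * ln (1 / \<pi> K)"
    by (simp add: penalized_loss_def)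
  have loss: "(norm (mixture y - f))\<^sup>2
      = (norm (y - mixture y))\<^sup>2 + 2 * (w \<bullet> mixture y) - 2 * (w \<bullet> f) - w \<bullet> w"
    by (simp add: y_def power2_norm_eq_inner inner_diff inner_add inner_commute algebra_simps)
  have resid: "(norm (x - P K x))\<^sup>2 = x \<bullet> x - x \<bullet> P K x" for x
    using norm_sq_residual[OF PK, of x] inner_orth_projection[OF PK, of x]
    by (simp add: power2_norm_eq_inner)
  have "f \<bullet> P K w = w \<bullet> P K f"
    using orth_projection_symmetric[OF PK, of f w] by (simp add: inner_commute)
  then have "(norm (y - P K y))\<^sup>2 
      = (norm (f - P K f))\<^sup>2 + 2 * (w \<bullet> f) + w \<bullet> w - 2 * (w \<bullet> P K f) - w \<bullet> P K w"
    unfolding resid by (simp add: y_def linear_add[OF orth_projection_linear[OF PK]] inner_add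
        inner_commute)
  then show ?thesis
    using sure unfolding y_def[symmetric] d_def[symmetric] noise loss
    by (simp add: algebra_simps)
qed

text \<open>
  The remainder in the pointwise bound has mean zero by Stein's identity, applied to each
  coordinate of \<open>G\<close>. Since the loss is nonnegative, being dominated by an integrable function also
  makes it integrable.
\<close>
theorem mixture_risk_le:
  fixes W :: "'n \<Rightarrow> 'w \<Rightarrow> real"
  assumes M: "prob_space M"
    and indep: "prob_space.indep_vars M (\<lambda>_. borel) W UNIV"
    and gauss: "\<And>i. distributed M lborel (W i) (normal_density 0 \<sigma>)"
    and \<sigma>: "0 < \<sigma>" "s = \<sigma>\<^sup>2"
    and K: "K \<in> A"
  shows "integrable M (\<lambda>\<omega>. (norm (mixture (f + (\<chi> i. W i \<omega>)) - f))\<^sup>2)" (is ?int)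
    and "(\<integral>\<omega>. (norm (mixture (f + (\<chi> i. W i \<omega>)) - f))\<^sup>2 \<partial>M)
      \<le> (norm (f - P K f))\<^sup>2 + s * (2 * k K - (\<Sum>i\<in>UNIV. P K (axis i 1) $ i)) + 4 * s * ln (1 / \<pi> K)"
      (is "_ \<le> ?b")
proof -
  interpret prob_space M by (rule M)
  note PK = proj[OF K]
  define g where "g i w = 2 * mixture (f + w) $ i - 2 * P K f $ i - P K w $ i" for i w
  define D where "D i w = 2 * mixture_deriv i (f + w) - P K (axis i 1) $ i" for i w
  define \<Xi> where "\<Xi> w = (\<Sum>i\<in>UNIV. w $ i * g i w - s * D i w)" for w
  let ?W = "\<lambda>\<omega>. \<chi> i. W i \<omega>"
  have stein: "has_bochner_integral M (\<lambda>\<omega>. W i \<omega> * g i (?W \<omega>) - \<sigma>\<^sup>2 * D i (?W \<omega>)) 0" for i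
  proof (rule stein_identity_coordinate[OF M indep gauss \<sigma>(1)])
        \<comment> \<open>One constant that serves for \<open>g\<close> and for \<open>D\<close>; the quotient by \<open>s\<close> is only needed for \<open>D\<close>.\<close>
    let ?C = "3 + 4 * norm f + (4 + 4 * (norm f)\<^sup>2) / s"
    show "((\<lambda>t. g i (w + t *\<^sub>R axis i 1)) has_real_derivative D i w) (at 0)" for w
      unfolding g_def D_def add.assoc[symmetric]
      by (intro DERIV_diff[where E = "P K (axis i 1) $ i"] DERIV_diff[where E = 0, simplified]
          DERIV_cmult mixture_has_deriv DERIV_const proj_has_deriv[OF K])
    have shift: "continuous_on UNIV (\<lambda>w. f + w)" by (intro continuous_intros)
    show "continuous_on UNIV (g i)"
      unfolding g_def[abs_def]
      by (intro continuous_intros continuous_on_compose2[OF cont_mixture_nth shift] cont_proj[OF K]) auto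
    show "continuous_on UNIV (D i)"
      unfolding D_def[abs_def]
      by (intro continuous_intros continuous_on_compose2[OF cont_mixture_deriv shift]) auto
    show "\<bar>g i w\<bar> \<le> ?C * (1 + norm w)" for w
    proof -
      have "\<bar>mixture (f + w) $ i\<bar> \<le> norm f + norm w"
        using mixture_nth_bound[of "f + w" i] norm_triangle_ineq[of f w] by linarith
      then have "\<bar>g i w\<bar> \<le> 4 * norm f + 3 * norm w"
        using proj_nth_le[OF K, of f i] proj_nth_le[OF K, of w i] unfolding g_def by linarith
      also have "\<dots> \<le> ?C * (1 + norm w)"
      proof -
        have "0 \<le> (4 * norm f + (4 + 4 * (norm f)\<^sup>2) / s) * norm w"
          "0 \<le> (4 + 4 * (norm f)\<^sup>2) / s" using s_pos by auto
        then show ?thesis unfolding distrib_left distrib_right by linarith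
      qed
      finally show ?thesis .
    qed
    show "\<bar>D i w\<bar> \<le> ?C * (1 + (norm w)\<^sup>2)" for w
    proof -
      have "(norm (f + w))\<^sup>2 \<le> (norm f + norm w)\<^sup>2"
        by (intro power_mono norm_triangle_ineq) simp
      also have "\<dots> \<le> 2 * (norm f)\<^sup>2 + 2 * (norm w)\<^sup>2"
        using zero_le_power2[of "norm f - norm w"] by (simp add: power2_sum power2_diff)
      finally have "(norm (f + w))\<^sup>2 / s \<le> (2 * (norm f)\<^sup>2 + 2 * (norm w)\<^sup>2) / s"
        using s_pos by (simp add: divide_right_mono)
      then have "\<bar>D i w\<bar> \<le> 3 + 2 * ((2 * (norm f)\<^sup>2 + 2 * (norm w)\<^sup>2) / s)"
        using mixture_deriv_bound[of i "f + w"] proj_nth_le[OF K, of "axis i 1" i]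
        unfolding D_def norm_axis_1 by linarith
      also have "\<dots> \<le> ?C * (1 + (norm w)\<^sup>2)"
      proof -
        have "?C * (1 + (norm w)\<^sup>2) - (3 + 2 * ((2 * (norm f)\<^sup>2 + 2 * (norm w)\<^sup>2) / s))
            = 4 * norm f + 4 / s + (3 + 4 * norm f + 4 * (norm f)\<^sup>2 / s) * (norm w)\<^sup>2"
          using s_pos by (simp add: field_simps)
        moreover have "0 \<le> \<dots>" using s_pos by simp
        ultimately show ?thesis by linarith
      qed
      finally show ?thesis .
    qed
  qed
  have "has_bochner_integral M (\<lambda>\<omega>. \<Xi> (?W \<omega>)) (\<Sum>i\<in>(UNIV :: 'n set). 0)"
    unfolding \<Xi>_def \<sigma>(2) vec_lambda_beta by (rule has_bochner_integral_sum) (rule stein)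
  then have \<Xi>: "integrable M (\<lambda>\<omega>. \<Xi> (?W \<omega>))" "(\<integral>\<omega>. \<Xi> (?W \<omega>) \<partial>M) = 0"
    by (simp_all add: has_bochner_integral_iff)
  have le: "(norm (mixture (f + w) - f))\<^sup>2 \<le> ?b + \<Xi> w" for w
    using mixture_loss_le[OF K, of f w] by (simp add: \<Xi>_def g_def D_def)
  have int_b: "integrable M (\<lambda>\<omega>. ?b + \<Xi> (?W \<omega>))"
    using \<Xi>(1) by simp
  show int: ?int
  proof (rule Bochner_Integration.integrable_bound[OF int_b])
    have W_meas [measurable]: "W j \<in> borel_measurable M" for j
      using distributed_measurable[OF gauss[of j]] by simp
    have [measurable]: "?W \<in> borel_measurable M"
      by (subst borel_measurable_euclidean_space) (auto simp: Basis_vec_def inner_axis)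
    have "continuous_on UNIV (\<lambda>w. (norm (mixture (f + w) - f))\<^sup>2)"
      unfolding norm_sq_vec vector_minus_component
      by (intro continuous_intros continuous_on_compose2[OF cont_mixture_nth, of _ "\<lambda>w. f + w"]) auto
    from borel_measurable_continuous_onI[OF this]
    have [measurable]: "(\<lambda>w. (norm (mixture (f + w) - f))\<^sup>2) \<in> borel_measurable borel" .
    show "(\<lambda>\<omega>. (norm (mixture (f + ?W \<omega>) - f))\<^sup>2) \<in> borel_measurable M"
      by measurable
    show "AE \<omega> in M. norm ((norm (mixture (f + ?W \<omega>) - f))\<^sup>2) \<le> norm (?b + \<Xi> (?W \<omega>))"
    proof (rule AE_I2)
      fix \<omega>
      show "norm ((norm (mixture (f + ?W \<omega>) - f))\<^sup>2) \<le> norm (?b + \<Xi> (?W \<omega>))"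
        using order_trans[OF le[of "?W \<omega>"] abs_ge_self] by simp
    qed
  qed
  have "(\<integral>\<omega>. (norm (mixture (f + ?W \<omega>) - f))\<^sup>2 \<partial>M) \<le> (\<integral>\<omega>. ?b + \<Xi> (?W \<omega>) \<partial>M)"
    by (rule integral_mono[OF int int_b]) (rule le)
  also have "\<dots> = ?b"
    using \<Xi> by (simp add: prob_space)
  finally show "(\<integral>\<omega>. (norm (mixture (f + ?W \<omega>) - f))\<^sup>2 \<partial>M) \<le> ?b" .
qed

end

section \<open>The sparsity prior and the penalty\<close>

text \<open>A weak form of Stirling's formula: the left-hand side is one term of the exponential series.\<close>
lemma power_self_le_exp_fact: "real k ^ k \<le> exp (real k) * fact k"
proof -
  have "(\<Sum>i\<in>{k}. real k ^ i /\<^sub>R fact i) \<le> (\<Sum>i. real k ^ i /\<^sub>R fact i)"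
    by (intro sum_le_suminf sums_summable[OF exp_converges]) auto
  then have "real k ^ k / fact k \<le> exp (real k)"
    using sums_unique[OF exp_converges[of "real k"]] by (simp add: divide_inverse mult.commute)
  then show ?thesis by (simp add: pos_divide_le_eq)
qed

lemma ln_binomial_le:
  assumes "0 < k" "k \<le> p"
  shows "ln (real (p choose k)) \<le> real k * ln (real p * exp 1 / real k)"
proof -
  have "real (p choose k) * fact k \<le> real p ^ k"
    using binomial_fact_pow[of p k] by (metis of_nat_fact of_nat_le_iff of_nat_mult of_nat_power)
  then have "real (p choose k) * fact k * real k ^ k \<le> real p ^ k * (exp (real k) * fact k)"
    by (intro mult_mono power_self_le_exp_fact) auto
  then have "real (p choose k) * real k ^ k \<le> real p ^ k * exp (real k)"
    by (simp add: mult_ac)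
  then have "real (p choose k) \<le> (real p * exp 1 / real k) ^ k"
    using assms by (simp add: power_divide power_mult_distrib pos_le_divide_eq exp_of_nat_mult[symmetric])
  moreover have "0 < real (p choose k)" using assms by simp
  ultimately have "ln (real (p choose k)) \<le> ln ((real p * exp 1 / real k) ^ k)"
    by (simp add: ln_mono)
  also have "\<dots> = real k * ln (real p * exp 1 / real k)"
    by (rule ln_realpow)
  finally show ?thesis .
qed

text \<open>The dimension term of the oracle bound, in units of \<open>\<sigma>\<^sup>2 / n\<close>; it is \<open>0\<close> for \<open>k = 0\<close>.\<close>
definition sparsity_penalty :: "nat \<Rightarrow> real \<Rightarrow> nat \<Rightarrow> real" where
  "sparsity_penalty p \<alpha> k = real k * (4 * ln (real p * exp 1 / (real k * \<alpha>)) + 1)"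

text \<open>
  With \<open>A = ln (p * e / \<alpha>)\<close> the penalty is \<open>k * (4 * (A - ln k) + 1)\<close>, with derivative
  \<open>4 * (A - ln k) - 3\<close>, and \<open>A - ln k \<ge> 1\<close> for \<open>k \<le> p\<close>. The proof replaces the derivative by the
  convexity inequality for \<open>x * ln x\<close>, which avoids the singularity at \<open>0\<close>.
\<close>
lemma sparsity_penalty_mono:
  assumes \<alpha>: "0 < \<alpha>" "\<alpha> < 1" and kl: "k \<le> l" and lp: "l \<le> p"
  shows "sparsity_penalty p \<alpha> k \<le> sparsity_penalty p \<alpha> l"
proof (cases "l = 0")
  case True
  then show ?thesis using kl by simp
next
  case l: False
  define A where "A = ln (real p * exp 1 / \<alpha>)"
  have penalty: "sparsity_penalty p \<alpha> m = real m * (4 * (A - ln (real m)) + 1)" if "0 < m" for m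
    using that \<alpha> l lp by (simp add: sparsity_penalty_def A_def ln_div ln_mult)
  have A: "1 \<le> A - ln (real l)"
  proof -
    have "ln (real l) \<le> ln (real p)" using l lp by simp
    moreover have "ln \<alpha> \<le> 0" using \<alpha> by simp
    moreover have "A = ln (real p) + 1 - ln \<alpha>" using l lp \<alpha> by (simp add: A_def ln_div ln_mult)
    ultimately show ?thesis by linarith
  qed
  show ?thesis
  proof (cases "k = 0")
    case True
    then have "sparsity_penalty p \<alpha> k = 0" by (simp add: sparsity_penalty_def)
    also have "0 \<le> sparsity_penalty p \<alpha> l" using A l by (simp add: penalty)
    finally show ?thesis .
  next
    case k: False
    have "ln (real l / real k) \<le> real l / real k - 1"
      using k l by (intro ln_le_minus_one) simp
    then have "real k * ln (real l / real k) \<le> real k * (real l / real k - 1)"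
      by (intro mult_left_mono) auto
    then have conv: "real k * ln (real l) - real k * ln (real k) \<le> real l - real k"
      using k l by (simp add: ln_div right_diff_distrib)
    have "0 \<le> (real l - real k) * (4 * (A - ln (real l)) - 4)"
      using kl A by (intro mult_nonneg_nonneg) auto
    then show ?thesis
      using conv kl k l by (simp add: penalty algebra_simps)
  qed
qed

lemma sparsity_prior_pos:
  fixes J :: "'p::finite set"
  assumes "0 < \<alpha>" "card J \<le> n"
  shows "0 < sparsity_prior n \<alpha> J"
proof -
  have "0 < (\<Sum>j=0..n. \<alpha> ^ j)" using assms by (intro sum_pos) auto
  moreover have "card J \<le> CARD('p)" by (simp add: card_mono)
  ultimately show ?thesis using assms by (simp add: sparsity_prior_def)
qed

text \<open>Within each size the prior is uniform, and the sizes carry truncated geometric weights.\<close>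
lemma sum_sparsity_prior:
  assumes "0 < \<alpha>" "n \<le> CARD('p::finite)"
  shows "(\<Sum>J | card J \<le> n. sparsity_prior n \<alpha> (J :: 'p set)) = 1"
proof -
  define S where "S = (\<Sum>j=0..n. \<alpha> ^ j)"
  have S: "0 < S" unfolding S_def using assms by (intro sum_pos) auto
  have "(\<Sum>J | card J \<le> n. sparsity_prior n \<alpha> (J :: 'p set))
      = (\<Sum>k\<in>{0..n}. \<Sum>J\<in>{J \<in> {J. card J \<le> n}. card J = k}. sparsity_prior n \<alpha> (J :: 'p set))"
    by (rule sum.group[symmetric]) auto
  also have "\<dots> = (\<Sum>k\<in>{0..n}. \<alpha> ^ k / S)"
  proof (rule sum.cong[OF refl])
    fix k assume k: "k \<in> {0..n}"
    have eq: "{J \<in> {J :: 'p set. card J \<le> n}. card J = k} = {J. J \<subseteq> UNIV \<and> card J = k}"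
      using k by auto
    have "(\<Sum>J\<in>{J \<in> {J. card J \<le> n}. card J = k}. sparsity_prior n \<alpha> (J :: 'p set))
        = (\<Sum>J\<in>{J :: 'p set. J \<subseteq> UNIV \<and> card J = k}. \<alpha> ^ k / S * inverse (real (CARD('p) choose k)))"
      unfolding eq using k by (intro sum.cong refl) (simp add: sparsity_prior_def S_def)
    also have "\<dots> = \<alpha> ^ k / S"
      using n_subsets[of "UNIV :: 'p set" k] k assms by simp
    finally show "(\<Sum>J\<in>{J \<in> {J. card J \<le> n}. card J = k}. sparsity_prior n \<alpha> (J :: 'p set)) = \<alpha> ^ k / S" .
  qed
  also have "\<dots> = 1" using S by (simp add: sum_divide_distrib[symmetric] S_def)
  finally show ?thesis .
qed

text \<open>
  The two parts of the penalty: the number of sub-models of the same size costs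
  \<open>k * ln (p * e / k)\<close>, and the geometric weight costs \<open>k * ln (1 / \<alpha>)\<close>. The normalization of the
  prior is at most the full geometric series \<open>1 / (1 - \<alpha>)\<close>.
\<close>
lemma ln_inverse_sparsity_prior_le:
  fixes J :: "'p::finite set"
  assumes \<alpha>: "0 < \<alpha>" "\<alpha> < 1" and J: "card J \<le> n"
  shows "real (card J) + 4 * ln (1 / sparsity_prior n \<alpha> J)
    \<le> sparsity_penalty CARD('p) \<alpha> (card J) + 4 * ln (1 / (1 - \<alpha>))"
proof -
  define k where "k = card J"
  define S where "S = (\<Sum>j=0..n. \<alpha> ^ j)"
  have S: "0 < S" unfolding S_def using \<alpha> by (intro sum_pos) auto
  have kp: "k \<le> CARD('p)" by (simp add: k_def card_mono)
  then have choose: "0 < real (CARD('p) choose k)" by simp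
  have "(1 - \<alpha>) * S = 1 - \<alpha> ^ Suc n"
    unfolding S_def atMost_atLeast0[symmetric] by (rule sum_gp_basic)
  then have "S * (1 - \<alpha>) \<le> 1" using \<alpha> by (simp add: mult.commute)
  then have "S \<le> 1 / (1 - \<alpha>)" using \<alpha> by (simp add: pos_le_divide_eq)
  then have ln_S: "ln S \<le> ln (1 / (1 - \<alpha>))" using S by (simp add: ln_mono)
  have "1 / sparsity_prior n \<alpha> J = S * real (CARD('p) choose k) / \<alpha> ^ k"
    using J by (simp add: sparsity_prior_def S_def k_def field_simps)
  then have "ln (1 / sparsity_prior n \<alpha> J) = ln S + ln (real (CARD('p) choose k)) - real k * ln \<alpha>"
    using S choose \<alpha> by (simp add: ln_div ln_mult ln_realpow)
  moreover have "ln (real (CARD('p) choose k)) - real k * ln \<alpha> \<le> real k * ln (real CARD('p) * exp 1 / (real k * \<alpha>))"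
  proof (cases "k = 0")
    case False
    then have "ln (real CARD('p) * exp 1 / (real k * \<alpha>)) = ln (real CARD('p) * exp 1 / real k) - ln \<alpha>"
      using \<alpha> by (simp add: ln_div ln_mult)
    then show ?thesis
      using ln_binomial_le[OF _ kp] False by (simp add: right_diff_distrib)
  qed simp
  ultimately show ?thesis
    using ln_S unfolding sparsity_penalty_def k_def[symmetric] by (simp add: distrib_left)
qed

section \<open>Least squares estimates as projections\<close>

definition fit :: "('p::finite \<Rightarrow> 'x \<Rightarrow> real) \<Rightarrow> ('n::finite \<Rightarrow> 'x) \<Rightarrow> real ^ 'p \<Rightarrow> real ^ 'n" where
  "fit \<phi> X \<theta> = (\<chi> i. lin_model \<phi> \<theta> (X i))"

definition regressor :: "('p::finite \<Rightarrow> 'x \<Rightarrow> real) \<Rightarrow> ('n::finite \<Rightarrow> 'x) \<Rightarrow> 'p \<Rightarrow> real ^ 'n" where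
  "regressor \<phi> X j = (\<chi> i. \<phi> j (X i))"

lemma fit_eq_sum: "fit \<phi> X \<theta> = (\<Sum>j\<in>UNIV. \<theta> $ j *\<^sub>R regressor \<phi> X j)"
  by (simp add: vec_eq_iff fit_def regressor_def lin_model_def)

lemma linear_fit: "linear (fit \<phi> X)"
  unfolding fit_eq_sum[abs_def]
  by (rule linearI) (simp_all add: scaleR_add_left sum.distrib scaleR_sum_right)

lemma fit_axis: "fit \<phi> X (axis j 1) = regressor \<phi> X j"
proof -
  have "fit \<phi> X (axis j 1) = (\<Sum>l\<in>UNIV. if l = j then regressor \<phi> X l else 0)"
    unfolding fit_eq_sum by (rule sum.cong) (auto simp: axis_def)
  then show ?thesis by simp
qed

lemma subspace_submodel: "subspace (submodel J)"
  by (auto simp: subspace_def submodel_def)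

lemma fit_submodel:
  fixes \<phi> :: "'p::finite \<Rightarrow> 'x \<Rightarrow> real" and J :: "'p set"
  shows "fit \<phi> X ` submodel J = span (regressor \<phi> X ` J)"
proof (rule antisym)
  show "fit \<phi> X ` submodel J \<subseteq> span (regressor \<phi> X ` J)"
  proof (rule image_subsetI)
    fix \<theta> :: "real ^ 'p" assume \<theta>: "\<theta> \<in> submodel J"
    have "\<theta> $ j *\<^sub>R regressor \<phi> X j \<in> span (regressor \<phi> X ` J)" for j
    proof (cases "j \<in> J")
      case True
      then show ?thesis by (intro span_scale span_base imageI)
    next
      case False
      then show ?thesis using \<theta> by (simp add: submodel_def span_zero)
    qed
    then show "fit \<phi> X \<theta> \<in> span (regressor \<phi> X ` J)"
      unfolding fit_eq_sum by (intro span_sum)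
  qed
next
  show "span (regressor \<phi> X ` J) \<subseteq> fit \<phi> X ` submodel J"
  proof (rule span_minimal)
    show "regressor \<phi> X ` J \<subseteq> fit \<phi> X ` submodel J"
    proof (rule image_subsetI)
      fix j assume "j \<in> J"
      then have "axis j 1 \<in> submodel J" by (auto simp: submodel_def axis_def)
      then show "regressor \<phi> X j \<in> fit \<phi> X ` submodel J"
        unfolding fit_axis[symmetric] by (rule imageI)
    qed
    show "subspace (fit \<phi> X ` submodel J)"
      by (rule linear_subspace_image[OF linear_fit subspace_submodel])
  qed
qed

lemma emp_risk_eq:
  fixes X :: "'n::finite \<Rightarrow> 'x"
  shows "emp_risk \<phi> X Y \<theta> = (norm ((\<chi> i. Y i) - fit \<phi> X \<theta>))\<^sup>2 / real CARD('n)"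
  by (simp add: emp_risk_def norm_sq_vec fit_def)

lemma emp_norm_eq:
  fixes X :: "'n::finite \<Rightarrow> 'x"
  shows "(emp_norm X (\<lambda>x. lin_model \<phi> \<theta> x - f x))\<^sup>2
    = (norm (fit \<phi> X \<theta> - (\<chi> i. f (X i))))\<^sup>2 / real CARD('n)"
  by (simp add: emp_norm_def norm_sq_vec fit_def sum_nonneg)

text \<open>
  A least squares estimate need not be unique, but its fitted values are: they are the point of
  the span that is closest to the data. So the fitted values of the aggregate are a continuous
  function of the noise, although the selection of the estimates is arbitrary.
\<close>
lemma fit_least_squares:
  fixes X :: "'n::finite \<Rightarrow> 'x"
  assumes P: "orth_projection P" "range P = span (regressor \<phi> X ` J)"
    and ls: "is_least_squares \<phi> X Y J \<theta>"
  shows "fit \<phi> X \<theta> = P (\<chi> i. Y i)"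
proof (rule minimal_distance_imp_orth_projection[OF P(1)])
  have \<theta>: "\<theta> \<in> submodel J" and min: "\<And>\<eta>. \<eta> \<in> submodel J \<Longrightarrow> emp_risk \<phi> X Y \<theta> \<le> emp_risk \<phi> X Y \<eta>"
    using ls by (auto simp: is_least_squares_def is_arg_min_def not_less)
  show "fit \<phi> X \<theta> \<in> range P"
    using \<theta> unfolding P(2) fit_submodel[symmetric] by (rule imageI)
  obtain \<eta> where \<eta>: "\<eta> \<in> submodel J" "P (\<chi> i. Y i) = fit \<phi> X \<eta>"
    using P(2) fit_submodel[of \<phi> X J] by (metis imageE rangeI)
  have "(norm ((\<chi> i. Y i) - fit \<phi> X \<theta>))\<^sup>2 \<le> (norm ((\<chi> i. Y i) - fit \<phi> X \<eta>))\<^sup>2"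
    using min[OF \<eta>(1)] by (simp add: emp_risk_eq divide_le_cancel)
  then show "norm ((\<chi> i. Y i) - fit \<phi> X \<theta>) \<le> norm ((\<chi> i. Y i) - P (\<chi> i. Y i))"
    unfolding \<eta>(2) by (rule power2_le_imp_le) simp
qed

text \<open>
  A basis is extracted from the family \<open>v\<close> restricted to \<open>J\<close>, not only from its image: \<open>v\<close> may take the
  same value twice, so indices are chosen on which \<open>v\<close> is injective.
\<close>
lemma free_submodel_exists:
  fixes v :: "'p::finite \<Rightarrow> 'a::euclidean_space"
  shows "\<exists>K\<subseteq>J. card K = dim (span (v ` K)) \<and> span (v ` K) = span (v ` J)"
proof -
  obtain B where B: "B \<subseteq> v ` J" "independent B" "v ` J \<subseteq> span B"
    by (metis maximal_independent_subset)
  obtain K where K: "K \<subseteq> J" "inj_on v K" "B = v ` K"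
    using B(1) by (auto simp: subset_image_inj)
  have "card K = dim (span (v ` K))"
    using K B(2) by (simp add: dim_eq_card_independent card_image)
  moreover have "span (v ` K) = span (v ` J)"
    using B K(3) by (metis span_eq span_superset subset_trans)
  ultimately show ?thesis using K(1) by blast
qed

section \<open>The oracle inequality\<close>

lemma oracle_bound_eq:
  fixes X :: "'n::finite \<Rightarrow> 'x" and \<phi> :: "'p::finite \<Rightarrow> 'x \<Rightarrow> real"
  shows "oracle_bound \<sigma> \<alpha> \<phi> X f \<theta> =
    ((norm (fit \<phi> X \<theta> - (\<chi> i. f (X i))))\<^sup>2
      + \<sigma>\<^sup>2 * (sparsity_penalty CARD('p) \<alpha> (card (param_support \<theta>)) + 4 * ln (1 / (1 - \<alpha>)))) / real CARD('n)"
  by (simp add: oracle_bound_def emp_norm_eq sparsity_penalty_def distrib_left add_divide_distrib mult_ac)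

text \<open>
  Replacing \<open>\<eta>\<close> by the best approximation within its own support decreases the approximation
  error and does not enlarge the support, hence does not increase the bound. There are only finitely
  many such candidates, one for each sub-model.
\<close>
lemma oracle_bound_attained:
  fixes X :: "'n::finite \<Rightarrow> 'x" and \<phi> :: "'p::finite \<Rightarrow> 'x \<Rightarrow> real"
  assumes \<alpha>: "0 < \<alpha>" "\<alpha> < 1"
  shows "\<exists>\<theta>\<^sub>0. is_arg_min (oracle_bound \<sigma> \<alpha> \<phi> X f) (\<lambda>_. True) \<theta>\<^sub>0"
proof -
  let ?f = "\<chi> i. f (X i)"
  have "\<exists>\<theta>\<in>submodel J. \<forall>\<eta>\<in>submodel J. norm (?f - fit \<phi> X \<theta>) \<le> norm (?f - fit \<phi> X \<eta>)" for J
  proof -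
    obtain P where P: "orth_projection P" "range P = span (regressor \<phi> X ` J)"
      using orth_projection_exists[OF subspace_span] by metis
    obtain \<theta> where \<theta>: "\<theta> \<in> submodel J" "P ?f = fit \<phi> X \<theta>"
      using P(2) fit_submodel[of \<phi> X J] by (metis imageE rangeI)
    have "norm (?f - fit \<phi> X \<theta>) \<le> norm (?f - fit \<phi> X \<eta>)" if "\<eta> \<in> submodel J" for \<eta>
      unfolding \<theta>(2)[symmetric] using that P(2) fit_submodel[of \<phi> X J]
      by (intro orth_projection_minimal[OF P(1)]) auto
    then show ?thesis using \<theta>(1) by blast
  qed
  then obtain t where t: "\<And>J. t J \<in> submodel J"
      "\<And>J \<eta>. \<eta> \<in> submodel J \<Longrightarrow> norm (?f - fit \<phi> X (t J)) \<le> norm (?f - fit \<phi> X \<eta>)"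
    by metis
  let ?B = "oracle_bound \<sigma> \<alpha> \<phi> X f"
  have le: "?B (t (param_support \<eta>)) \<le> ?B \<eta>" for \<eta>
  proof -
    have "\<eta> \<in> submodel (param_support \<eta>)" by (simp add: submodel_def param_support_def)
    from t(2)[OF this] have "(norm (fit \<phi> X (t (param_support \<eta>)) - ?f))\<^sup>2 \<le> (norm (fit \<phi> X \<eta> - ?f))\<^sup>2"
      by (simp add: norm_minus_commute power_mono)
    moreover have "param_support (t (param_support \<eta>)) \<subseteq> param_support \<eta>"
      using t(1)[of "param_support \<eta>"] by (auto simp: submodel_def param_support_def)
    then have "sparsity_penalty CARD('p) \<alpha> (card (param_support (t (param_support \<eta>))))
        \<le> sparsity_penalty CARD('p) \<alpha> (card (param_support \<eta>))"
      using \<alpha> by (intro sparsity_penalty_mono card_mono) auto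
    ultimately show ?thesis
      unfolding oracle_bound_eq by (intro divide_right_mono add_mono mult_left_mono) auto
  qed
  have "finite (range t)" by simp
  then obtain \<theta>\<^sub>0 where "is_arg_min ?B (\<lambda>\<theta>. \<theta> \<in> range t) \<theta>\<^sub>0"
    using ex_is_arg_min_if_finite[of "range t" ?B] by blast
  then have "?B \<theta>\<^sub>0 \<le> ?B (t J)" for J
    by (auto simp: is_arg_min_def not_less)
  then have "?B \<theta>\<^sub>0 \<le> ?B \<eta>" for \<eta>
    using le order_trans by blast
  then show ?thesis by (auto simp: is_arg_min_def not_less)
qed

theorem theorem2p1:
  fixes \<X> :: "'x measure"
    and X :: "'n::finite \<Rightarrow> 'x"
    and f :: "'x \<Rightarrow> real"
    and \<phi> :: "'p::finite \<Rightarrow> 'x \<Rightarrow> real"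
    and M :: "'w measure"
    and W :: "'n \<Rightarrow> 'w \<Rightarrow> real"
    and Y :: "'w \<Rightarrow> 'n \<Rightarrow> real"
    and \<sigma> \<alpha> \<tau> :: real
    and \<theta>ls :: "'w \<Rightarrow> 'p set \<Rightarrow> real ^ 'p"
    and \<theta>hat :: "'w \<Rightarrow> real ^ 'p"
  assumes p_gt_n: "CARD('p) > CARD('n)"
    and X_in: "\<And>i. X i \<in> space \<X>"
    and M: "prob_space M"
    and W_indep: "prob_space.indep_vars M (\<lambda>_. borel) W UNIV"
    and W_gauss: "\<And>i. distributed M lborel (W i) (normal_density 0 \<sigma>)"
    and sigma_pos: "\<sigma> > 0"
    and Y_eq: "\<And>\<omega> i. Y \<omega> i = f (X i) + W i \<omega>"
    and phi_normalised: "\<And>j. (1 / real CARD('n)) * (\<Sum>i\<in>UNIV. (\<phi> j (X i))\<^sup>2) = 1"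
    and alpha: "0 < \<alpha>" "\<alpha> < 1"
    and temperature: "\<tau> = real CARD('n) / (4 * \<sigma>\<^sup>2)"
    and least_squares:
      "\<And>\<omega> J. \<omega> \<in> space M \<Longrightarrow> card J \<le> CARD('n) \<Longrightarrow> is_least_squares \<phi> X (Y \<omega>) J (\<theta>ls \<omega> J)"
    and theta_hat:
      "\<And>\<omega>. \<theta>hat \<omega> = exp_aggregate \<sigma> \<tau> (sparsity_prior CARD('n) \<alpha>) \<phi> X (Y \<omega>) (\<theta>ls \<omega>)"
  shows "integrable M (\<lambda>\<omega>. (emp_norm X (\<lambda>x. lin_model \<phi> (\<theta>hat \<omega>) x - f x))\<^sup>2) \<and>
    (\<exists>\<theta>\<^sub>0. is_arg_min (oracle_bound \<sigma> \<alpha> \<phi> X f) (\<lambda>_. True) \<theta>\<^sub>0 \<and>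
      (\<integral>\<omega>. (emp_norm X (\<lambda>x. lin_model \<phi> (\<theta>hat \<omega>) x - f x))\<^sup>2 \<partial>M) \<le> oracle_bound \<sigma> \<alpha> \<phi> X f \<theta>\<^sub>0)"
proof -
  define s where "s = \<sigma>\<^sup>2"
  have s: "0 < s" using sigma_pos by (simp add: s_def)
  let ?n = "CARD('n)" and ?\<pi> = "sparsity_prior CARD('n) \<alpha> :: 'p set \<Rightarrow> real"
  let ?S = "\<lambda>J. span (regressor \<phi> X ` J)"
  let ?f = "\<chi> i. f (X i)" and ?W = "\<lambda>\<omega>. \<chi> i. W i \<omega>"
  have "\<exists>P. \<forall>J. orth_projection (P J) \<and> range (P J) = ?S J \<and> (\<Sum>b\<in>Basis. P J b \<bullet> b) = dim (?S J)"
    by (intro choice allI orth_projection_exists subspace_span)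
  then obtain P where P: "\<And>J. orth_projection (P J)" "\<And>J. range (P J) = ?S J"
      and "\<And>J. (\<Sum>b\<in>Basis. P J b \<bullet> b) = dim (?S J)"
    by blast
  then have trace: "(\<Sum>i\<in>UNIV. P J (axis i 1) $ i) = dim (?S J)" for J
    by (simp add: sum_Basis_vec inner_axis)
  define A where "A = {J :: 'p set. card J \<le> ?n}"
  interpret penalized_projection_mixture A P ?\<pi> "\<lambda>J. real (card J)" s
  proof unfold_locales
    show "finite A" by simp
    show "A \<noteq> {}" by (auto simp: A_def intro: exI[of _ "{}"])
    show "orth_projection (P J)" for J by (rule P(1))
    show "0 < ?\<pi> J * exp (- (real (card J) / 2))" if "J \<in> A" for J
      using sparsity_prior_pos[OF alpha(1), of J ?n] that by (simp add: A_def)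
    show "0 < s" by (rule s)
    show "(\<Sum>J\<in>A. ?\<pi> J) \<le> 1"
      unfolding A_def using sum_sparsity_prior[OF alpha(1), where 'p = 'p and n = ?n] p_gt_n by simp
    show "(\<Sum>i\<in>UNIV. P J (axis i 1) $ i) \<le> real (card J)" for J
      unfolding trace using dim_le_card'[of "regressor \<phi> X ` J"] card_image_le[of J "regressor \<phi> X"]
      by simp
  qed
  have fit_aggregate: "fit \<phi> X (\<theta>hat \<omega>) = mixture (?f + ?W \<omega>)" if \<omega>: "\<omega> \<in> space M" for \<omega>
  proof -
    define y where "y = ?f + ?W \<omega>"
    have y: "(\<chi> i. Y \<omega> i) = y" by (simp add: y_def vec_eq_iff Y_eq)
    have fit_ls: "fit \<phi> X (\<theta>ls \<omega> J) = P J y" if "J \<in> A" for J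
      using fit_least_squares[OF P(1) P(2) least_squares[OF \<omega>]] that by (simp add: A_def y)
    have w: "exp_weight \<sigma> \<tau> ?\<pi> \<phi> X (Y \<omega>) (\<theta>ls \<omega>) J = ?\<pi> J * exp (- (penalized_loss y J / (4 * s)))"
      if "J \<in> A" for J
      using s by (simp add: exp_weight_def emp_risk_eq y fit_ls[OF that] penalized_loss_def
          temperature s_def[symmetric] field_simps)
    have "fit \<phi> X (\<theta>hat \<omega>) $ i = mixture y $ i" for i
    proof -
      have "fit \<phi> X (\<theta>hat \<omega>) = (\<Sum>J\<in>A. exp_weight \<sigma> \<tau> ?\<pi> \<phi> X (Y \<omega>) (\<theta>ls \<omega>) J *\<^sub>R fit \<phi> X (\<theta>ls \<omega> J)) /\<^sub>R
          (\<Sum>J\<in>A. exp_weight \<sigma> \<tau> ?\<pi> \<phi> X (Y \<omega>) (\<theta>ls \<omega>) J)"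
        by (simp add: theta_hat exp_aggregate_def A_def linear_scale[OF linear_fit] linear_sum[OF linear_fit])
      also have "\<dots> = (\<Sum>J\<in>A. (?\<pi> J * exp (- (penalized_loss y J / (4 * s)))) *\<^sub>R P J y) /\<^sub>R
          (\<Sum>J\<in>A. ?\<pi> J * exp (- (penalized_loss y J / (4 * s))))"
        by (simp add: w fit_ls)
      finally have fit_eq: "fit \<phi> X (\<theta>hat \<omega>) = \<dots>" .
      have mix_eq: "mixture y $ i = (\<Sum>J\<in>A. ?\<pi> J * exp (- (penalized_loss y J / (4 * s))) * P J y $ i)
          / (\<Sum>J\<in>A. ?\<pi> J * exp (- (penalized_loss y J / (4 * s))))"
        by (subst mixture_nth) (rule mean_penalized_loss)
      show ?thesis
        by (subst fit_eq, subst mix_eq) (simp only: vector_scaleR_component sum_component divide_inverse_commute real_scaleR_def)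
    qed
    then show ?thesis by (simp add: vec_eq_iff y_def)
  qed
  have loss: "(emp_norm X (\<lambda>x. lin_model \<phi> (\<theta>hat \<omega>) x - f x))\<^sup>2 = (norm (mixture (?f + ?W \<omega>) - ?f))\<^sup>2 / ?n"
    if "\<omega> \<in> space M" for \<omega>
    using fit_aggregate[OF that] by (simp add: emp_norm_eq)
  note risk = mixture_risk_le[OF M W_indep W_gauss sigma_pos s_def, of _ ?f]
  have "{} \<in> A" by (simp add: A_def)
  then have int: "integrable M (\<lambda>\<omega>. (emp_norm X (\<lambda>x. lin_model \<phi> (\<theta>hat \<omega>) x - f x))\<^sup>2)"
    using risk(1) by (subst Bochner_Integration.integrable_cong[OF refl loss]) auto
  have "(\<integral>\<omega>. (emp_norm X (\<lambda>x. lin_model \<phi> (\<theta>hat \<omega>) x - f x))\<^sup>2 \<partial>M) \<le> oracle_bound \<sigma> \<alpha> \<phi> X f \<theta>" for \<theta>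
  proof -
    let ?J = "param_support \<theta>"
        \<comment> \<open>The support of \<open>\<theta>\<close> may have more than \<open>n\<close> elements; a basis of its span never does.\<close>
    obtain K where K: "K \<subseteq> ?J" "card K = dim (?S K)" "?S K = ?S ?J"
      using free_submodel_exists by blast
    have "card K \<le> ?n"
      unfolding K(2) using dim_subset_UNIV[of "?S K"] by simp
    then have KA: "K \<in> A" by (simp add: A_def)
    have "\<theta> \<in> submodel ?J" by (simp add: submodel_def param_support_def)
    then have "fit \<phi> X \<theta> \<in> fit \<phi> X ` submodel ?J" by (rule imageI)
    then have "fit \<phi> X \<theta> \<in> range (P K)"
      by (simp only: P(2) K(3) fit_submodel)
    then have "norm (?f - P K ?f) \<le> norm (?f - fit \<phi> X \<theta>)"
      by (rule orth_projection_minimal[OF P(1)])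
    then have approx: "(norm (?f - P K ?f))\<^sup>2 \<le> (norm (fit \<phi> X \<theta> - ?f))\<^sup>2"
      by (simp add: norm_minus_commute power_mono)
    have "real (card K) + 4 * ln (1 / ?\<pi> K)
        \<le> sparsity_penalty CARD('p) \<alpha> (card K) + 4 * ln (1 / (1 - \<alpha>))"
      using KA by (intro ln_inverse_sparsity_prior_le alpha) (simp add: A_def)
    also have "sparsity_penalty CARD('p) \<alpha> (card K) \<le> sparsity_penalty CARD('p) \<alpha> (card ?J)"
      by (intro sparsity_penalty_mono alpha card_mono K(1)) auto
    finally have penalty: "s * (real (card K) + 4 * ln (1 / ?\<pi> K))
        \<le> s * (sparsity_penalty CARD('p) \<alpha> (card ?J) + 4 * ln (1 / (1 - \<alpha>)))"
      using s by (intro mult_left_mono) auto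
    have "(\<integral>\<omega>. (emp_norm X (\<lambda>x. lin_model \<phi> (\<theta>hat \<omega>) x - f x))\<^sup>2 \<partial>M)
        = (\<integral>\<omega>. (norm (mixture (?f + ?W \<omega>) - ?f))\<^sup>2 \<partial>M) / ?n"
      by (subst Bochner_Integration.integral_cong[OF refl loss]) auto
    also have "\<dots> \<le> ((norm (?f - P K ?f))\<^sup>2 + s * (real (card K) + 4 * ln (1 / ?\<pi> K))) / ?n"
      using risk(2)[OF KA] unfolding trace K(2)[symmetric]
      by (intro divide_right_mono) (auto simp: algebra_simps)
    also have "\<dots> \<le> oracle_bound \<sigma> \<alpha> \<phi> X f \<theta>"
      unfolding oracle_bound_eq s_def[symmetric]
      by (intro divide_right_mono add_mono approx penalty) auto
    finally show ?thesis .
  qed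
  then show ?thesis using int oracle_bound_attained[OF alpha] by blast
qed

end
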